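(* Let $p>2$, let $w\ge0$ be an even integer, and let $\mu$ be a $p$-core which is either empty or a square $(j^j)$ with $j\ge1$. Then there exists a JS-partition $\lambda$ fixed under the Mullineux map with $p$-weight $w$ and $p$-core $\lambda_{(p)}=\mu$, except in the case $w=2$ and $\mu=\left(\left(\tfrac{p-1}{2}\right)^{\frac{p-1}{2}}\right)$, in which no such partition exists.
   Context: Fix an integer $p\ge 2$. A partition is written $\lambda=(l_1^{a_1},\dots,l_t^{a_t})$ with $l_1>\dots>l_t>0$, $a_i\ge1$; $(j^j)$ is the partition with $j$ parts equal to $j$. It is $p$-regular if all $a_i\le p-1$. A $p$-regular $\lambda$ is a JS-partition if $l_i-l_{i+1}+a_i+a_{i+1}\equiv 0\pmod p$ for $1\le i<t$. The $p$-core $\lambda_{(p)}$ is obtained by repeatedly removing rim hooks of length $p$ until none remains; a $p$-core is a partition equal to its own $p$-core; the $p$-weight is $(|\lambda|-|\lambda_{(p)}|)/p$. Mullineux symbol: the rim of $\lambda$ is the set of nodes $(i,j)$ of the Young diagram with $(i+1,j+1)$ not in it, ordered from the end of the first row to the start of the last row. The $p$-rim is the union of $p$-segments: the first consists of the first $p$ nodes of the rim (or all of it), each next one consists of the first $p$ (or all remaining) rim nodes starting at the last node of the row just below the lowest row of the previous segment, until the last row is reached. Let $a_1$ = size of the $p$-rim of $\lambda^{(1)}=\lambda$, $r_1$ = its number of parts; removing the $p$-rim gives $\lambda^{(2)}$; iterate until $\lambda^{(m+1)}=\emptyset$, defining $a_j,r_j$ for $\lambda^{(j)}$. The Mullineux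 symbol $G_p(\lambda)=\begin{pmatrix}a_1&\cdots&a_m\\ r_1&\cdots&r_m\end{pmatrix}$ determines $\lambda$. The Mullineux map sends $\lambda$ to the $p$-regular partition $\lambda^M$ with Mullineux symbol $\begin{pmatrix}a_1&\cdots&a_m\\ s_1&\cdots&s_m\end{pmatrix}$, $s_j=a_j-r_j+\varepsilon_j$, where $\varepsilon_j=0$ if $p\mid a_j$ and $\varepsilon_j=1$ otherwise; $\lambda$ is fixed if $\lambda^M=\lambda$. *)

theory Defs
  imports "HOL-Number_Theory.Cong"
begin

text \<open>
  A partition is the weakly decreasing list of its positive parts, so \<open>(j\<^sup>j)\<close> is
  \<open>replicate j j\<close>. Nodes of Young diagrams are pairs (row, column), counted from 0.
\<close>

definition is_partition :: "nat list \<Rightarrow> bool" where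
  "is_partition l \<longleftrightarrow> sorted_wrt (\<ge>) l \<and> 0 \<notin> set l"

definition p_regular :: "nat \<Rightarrow> nat list \<Rightarrow> bool" where
  "p_regular p l \<longleftrightarrow> is_partition l \<and> (\<forall>x\<in>set l. count_list l x \<le> p - 1)"

text \<open>
  For a partition \<open>l = (l\<^sub>1^a\<^sub>1, \<dots>, l\<^sub>t^a\<^sub>t)\<close>, the list \<open>remdups_adj l\<close> is
  \<open>[l\<^sub>1, \<dots>, l\<^sub>t]\<close>, and \<open>a\<^sub>i\<close> is the number of occurrences of \<open>l\<^sub>i\<close> in \<open>l\<close>. The
  subtraction below does not truncate, since these entries are strictly decreasing.
\<close>

definition JS_partition :: "nat \<Rightarrow> nat list \<Rightarrow> bool" where
  "JS_partition p l \<longleftrightarrow> p_regular p l \<and>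
     (let d = remdups_adj l in
      \<forall>i. Suc i < length d \<longrightarrow>
        [d ! i - d ! Suc i + count_list l (d ! i) + count_list l (d ! Suc i) = 0] (mod p))"

definition diagram :: "nat list \<Rightarrow> (nat \<times> nat) set" where
  "diagram l = {(i, j). i < length l \<and> j < l ! i}"

text \<open>The rim, ordered from the end of the first row to the start of the last row.\<close>

definition rim :: "nat list \<Rightarrow> (nat \<times> nat) list" where
  "rim l = filter (\<lambda>(i, j). (Suc i, Suc j) \<notin> diagram l)
     (concat (map (\<lambda>i. map (Pair i) (rev [0..<l ! i])) [0..<length l]))"

text \<open>
  A rim hook is a connected piece of the rim whose removal leaves a Young diagram; the
  connected pieces of the rim are its blocks of consecutive nodes.
\<close>

definition rim_hook_removal :: "nat \<Rightarrow> nat list \<Rightarrow> nat list \<Rightarrow> bool" where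
  "rim_hook_removal p l m \<longleftrightarrow> is_partition l \<and> is_partition m \<and>
     (\<exists>xs h ys. rim l = xs @ h @ ys \<and> length h = p \<and> diagram m = diagram l - set h)"

definition p_core :: "nat \<Rightarrow> nat list \<Rightarrow> nat list" where
  "p_core p l = (THE m. (rim_hook_removal p)\<^sup>*\<^sup>* l m \<and> (\<nexists>n. rim_hook_removal p m n))"

definition is_p_core :: "nat \<Rightarrow> nat list \<Rightarrow> bool" where
  "is_p_core p l \<longleftrightarrow> is_partition l \<and> p_core p l = l"

definition p_weight :: "nat \<Rightarrow> nat list \<Rightarrow> nat" where
  "p_weight p l = (sum_list l - sum_list (p_core p l)) div p"

text \<open>
  The \<open>p\<close>-segments read off from a final piece \<open>xs\<close> of the rim starting at the end of a
  row. Dropping the nodes in rows not below the last node of a segment leaves the rim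
  from the last node of the next row on, because the last node of a row lies in the rim.
\<close>

function p_segments :: "nat \<Rightarrow> (nat \<times> nat) list \<Rightarrow> (nat \<times> nat) list list" where
  "p_segments p xs =
     (if p = 0 \<or> xs = [] then []
      else let s = take p xs in s # p_segments p (filter (\<lambda>n. fst (last s) < fst n) xs))"
  by auto
termination
proof (relation "measure (\<lambda>(p, xs). length xs)", goal_cases)
  case (2 p xs s)
  then have "s \<noteq> []" by simp
  then have "last s \<in> set xs"
    using 2 by (metis in_set_takeD last_in_set)
  then show ?case by (auto intro: length_filter_less)
qed simp

declare p_segments.simps [simp del]

definition p_rim :: "nat \<Rightarrow> nat list \<Rightarrow> (nat \<times> nat) set" where
  "p_rim p l = set (concat (p_segments p (rim l)))"

definition remove_p_rim :: "nat \<Rightarrow> nat list \<Rightarrow> nat list" where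
  "remove_p_rim p l =
     filter (\<lambda>x. 0 < x) (map (\<lambda>i. card {j. (i, j) \<in> diagram l - p_rim p l}) [0..<length l])"

lemma set_rim: "set (rim l) = {(i, j) \<in> diagram l. (Suc i, Suc j) \<notin> diagram l}"
proof -
  have "set (concat (map (\<lambda>i. map (Pair i) (rev [0..<l ! i])) [0..<length l])) = diagram l"
    by (auto simp: diagram_def)
  then show ?thesis by (auto simp: rim_def simp del: set_concat)
qed

lemma sum_list_filter_pos: "sum_list (filter (\<lambda>x. 0 < x) xs) = sum_list (xs :: nat list)"
  by (induction xs) auto

lemma remove_p_rim_less:
  assumes "p \<noteq> 0" "l \<noteq> []"
  shows "sum_list (remove_p_rim p l) + length (remove_p_rim p l) < sum_list l + length l"
proof -
  let ?f = "\<lambda>i. card {j. (i, j) \<in> diagram l - p_rim p l}"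
  have len: "length (remove_p_rim p l) \<le> length l"
    unfolding remove_p_rim_def by (metis length_filter_le length_map length_upt minus_nat.diff_0)
  have sumf: "sum_list (remove_p_rim p l) = (\<Sum>i<length l. ?f i)"
    unfolding remove_p_rim_def sum_list_filter_pos
    by (simp add: interv_sum_list_conv_sum_set_nat atLeast0LessThan)
  have suml: "sum_list l = (\<Sum>i<length l. l ! i)"
    by (simp add: sum_list_sum_nth atLeast0LessThan)
  have sub: "{j. (i, j) \<in> diagram l - p_rim p l} \<subseteq> {..<l ! i}" for i
    by (auto simp: diagram_def)
  have le: "?f i \<le> l ! i" for i
    using card_mono[OF _ sub[of i]] by simp
  show ?thesis
  proof (cases "rim l = []")
    case False
    then have "hd (rim l) \<in> p_rim p l"
      using assms p_segments.simps[of p "rim l"]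
      by (cases p; cases "rim l") (auto simp: p_rim_def Let_def simp del: filter.simps)
    moreover have "hd (rim l) \<in> diagram l"
      using hd_in_set[OF False] unfolding set_rim by auto
    ultimately obtain i j where ij: "(i, j) \<in> p_rim p l" "(i, j) \<in> diagram l"
      by (metis surj_pair)
    then have "{j. (i, j) \<in> diagram l - p_rim p l} \<subset> {..<l ! i}"
      using sub[of i] by (auto simp: diagram_def)
    then have "?f i < l ! i"
      using psubset_card_mono[of "{..<l ! i}"] by simp
    moreover have "i \<in> {..<length l}"
      using ij by (simp add: diagram_def)
    ultimately have "(\<Sum>i<length l. ?f i) < (\<Sum>i<length l. l ! i)"
      by (intro sum_strict_mono_ex1) (use le in blast)+
    then show ?thesis using len sumf suml by simp
  next
    case True
    have "diagram l = {}"
    proof (rule ccontr)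
      assume "diagram l \<noteq> {}"
      then obtain n where n: "n \<in> diagram l" by blast
      obtain m where m: "m \<in> diagram l" "\<forall>k. k \<in> diagram l \<longrightarrow> fst k \<le> fst m"
        using ex_has_greatest_nat[of "\<lambda>k. k \<in> diagram l" n fst "length l"] n
        by (auto simp: diagram_def)
      then have "m \<in> set (rim l)"
        unfolding set_rim by (cases m) fastforce
      then show False using True by simp
    qed
    then have "remove_p_rim p l = []"
      by (simp add: remove_p_rim_def)
    then show ?thesis using assms by simp
  qed
qed

text \<open>The symbol is the list of its columns \<open>(a\<^sub>j, r\<^sub>j)\<close>.\<close>

function mullineux_symbol :: "nat \<Rightarrow> nat list \<Rightarrow> (nat \<times> nat) list" where
  "mullineux_symbol p l =
     (if p = 0 \<or> l = [] then []
      else (card (p_rim p l), length l) # mullineux_symbol p (remove_p_rim p l))"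
  by auto
termination
  by (relation "measure (\<lambda>(p, l). sum_list l + length l)") (auto simp: remove_p_rim_less)

declare mullineux_symbol.simps [simp del]

text \<open>
  The subtraction does not truncate: \<open>r \<le> a\<close> for every column \<open>(a, r)\<close> of a Mullineux
  symbol, since the \<open>p\<close>-rim meets every row.
\<close>

definition mullineux_conj_symbol :: "nat \<Rightarrow> (nat \<times> nat) list \<Rightarrow> (nat \<times> nat) list" where
  "mullineux_conj_symbol p = map (\<lambda>(a, r). (a, a - r + (if p dvd a then 0 else 1)))"

text \<open>
  The Mullineux map, as a partial function: its value is the unique \<open>p\<close>-regular partition
  with the conjugate symbol. That it is defined on every \<open>p\<close>-regular partition is a theorem
  and not built into the definition.
\<close>

definition mullineux_map :: "nat \<Rightarrow> nat list \<Rightarrow> nat list option" where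
  "mullineux_map p l =
     (let P = (\<lambda>m. p_regular p m \<and>
                mullineux_symbol p m = mullineux_conj_symbol p (mullineux_symbol p l))
      in if \<exists>!m. P m then Some (THE m. P m) else None)"

definition mullineux_fixed :: "nat \<Rightarrow> nat list \<Rightarrow> bool" where
  "mullineux_fixed p l \<longleftrightarrow> mullineux_map p l = Some l"

end

theory Submission
  imports Defs
begin

text \<open>
  Write \<open>l\<^sub>i - i\<close> for the beta numbers of a partition. Removing a rim hook of length \<open>p\<close> deletes
  nodes with \<open>p\<close> consecutive contents, so it preserves the number of beta numbers in each residue
  class, and these numbers determine the \<open>p\<close>-core. For a JS-partition with \<open>r\<close> parts the beta
  numbers are, modulo \<open>p\<close> and up to order, \<open>r\<close> consecutive integers starting at
  \<open>l\<^sub>1 - a\<^sub>1 + 1\<close>; hence it has the same core as \<open>(r\<^sup>r)\<close> if \<open>l\<^sub>1 \<equiv> a\<^sub>1\<close>.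

  Existence, with \<open>w = 2k\<close> and core \<open>(j\<^sup>j)\<close>: put a row of length \<open>kp + 1\<close> on top of \<open>p - 1\<close> rows
  of sizes as equal as possible followed by \<open>(j\<^sup>j)\<close> if \<open>j < k\<close>, and on top of
  \<open>((j+2)\<^sup>j, k\<^sup>a, (k-1)\<^sup>b)\<close> if \<open>k \<le> j\<close>. In both families, removing the \<open>p\<close>-rim replaces
  \<open>(j, k)\<close> by \<open>(j - 1, k - 1)\<close> until a square is left, so every column of the symbol is seen to be
  self-conjugate. Only \<open>k = 1\<close>, \<open>p = 2j\<close> needs a separate partition.

  Nonexistence for \<open>p = 2j + 1\<close>, \<open>w = 2\<close>: the residues force \<open>r \<in> {j, j + 1}\<close> or \<open>r \<ge> p + j\<close>. The
  first two cases contradict the first column of the symbol. In the last one that column gives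
  \<open>l\<^sub>1 \<ge> r\<close>, and then the two hooks added to \<open>(j\<^sup>j)\<close> must be a horizontal and a vertical strip,
  so that \<open>l\<close> has \<open>p\<close> parts equal to 1.
\<close>

section \<open>The rim\<close>

text \<open>The rim nodes in a row of length \<open>x\<close> with the rows \<open>xs\<close> below it are the columns \<open>lo xs..<x\<close>.\<close>

definition lo :: "nat list \<Rightarrow> nat" where
  "lo xs = (case xs of [] \<Rightarrow> 0 | y # ys \<Rightarrow> y - 1)"

lemma lo_simps [simp]: "lo [] = 0" "lo (y # ys) = y - 1"
  by (simp_all add: lo_def)

lemma is_partition_Cons:
  "is_partition (x # xs) \<longleftrightarrow> 0 < x \<and> is_partition xs \<and> (\<forall>y\<in>set xs. y \<le> x)"
  by (auto simp: is_partition_def)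

lemma is_partition_Nil [simp]: "is_partition []"
  by (simp add: is_partition_def)

lemma lo_less: "is_partition (x # xs) \<Longrightarrow> lo xs < x"
  by (cases xs) (auto simp: is_partition_Cons)

lemma filter_le_upt: "filter (\<lambda>j. a \<le> j) [0..<x] = [a..<x]"
  by (induction x) auto

lemma rim_Nil [simp]: "rim [] = []"
  by (simp add: rim_def)

text \<open>A node (0, j) belongs to the rim iff row 1 lacks column j + 1, that is iff
  \<open>lo xs\<close> is at most j. This turns later arguments about the rim into inductions over
  rows.\<close>

lemma rim_Cons: "rim (x # xs) = map (Pair 0) (rev [lo xs..<x]) @ map (apfst Suc) (rim xs)"
proof -
  have upt: "[0..<length (x # xs)] = 0 # map Suc [0..<length xs]"
    by (simp add: upt_conv_Cons map_Suc_upt del: upt_Suc)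
  have nd: "(Suc 0, Suc j) \<notin> diagram (x # xs) \<longleftrightarrow> lo xs \<le> j" for j
    by (cases xs) (auto simp: diagram_def)
  have 1: "filter (\<lambda>(i, j). (Suc i, Suc j) \<notin> diagram (x # xs)) (map (Pair 0) (rev [0..<x]))
      = map (Pair 0) (rev [lo xs..<x])"
    by (simp add: filter_map o_def nd rev_filter [symmetric] filter_le_upt)
  have 2: "filter (\<lambda>(i, j). (Suc i, Suc j) \<notin> diagram (x # xs))
        (concat (map (\<lambda>i. map (Pair (Suc i)) (rev [0..<xs ! i])) [0..<length xs]))
      = map (apfst Suc) (rim xs)"
    by (auto simp: rim_def filter_concat map_concat o_def filter_map diagram_def
        intro!: arg_cong [where f = concat] map_cong filter_cong)
  show ?thesis
    unfolding rim_def [of "x # xs"] upt using 1 2 by (simp add: o_def)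
qed

definition content :: "nat \<times> nat \<Rightarrow> int" where
  "content n = int (snd n) - int (fst n)"

text \<open>Within a row the content drops by one from node to node, and the last rim node of a row
  lies directly above the first one of the next row, so it drops by one there as well. Consecutive
  rim nodes thus have consecutive contents, and the length of the rim follows.\<close>

lemma content_rim:
  "is_partition l \<Longrightarrow> l \<noteq> [] \<Longrightarrow>
     map content (rim l) = map (\<lambda>k. int (hd l) - 1 - int k) [0..<hd l + length l - 1]"
proof (induction l)
  case (Cons x xs)
  have lo: "lo xs < x" using Cons.prems by (simp add: lo_less)
  have A: "map content (map (Pair 0) (rev [lo xs..<x])) = map (\<lambda>k. int x - 1 - int k) [0..<x - lo xs]"
    by (rule nth_equalityI) (auto simp: content_def rev_nth)
  have S: "content (apfst Suc n) = content n - 1" for n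
    by (cases n) (simp add: content_def)
  show ?case
  proof (cases xs)
    case Nil
    then show ?thesis using A by (simp add: rim_Cons)
  next
    case (Cons y ys)
    have IH: "map content (rim xs) = map (\<lambda>k. int y - 1 - int k) [0..<y + length xs - 1]"
      using Cons Cons.IH Cons.prems by (simp add: is_partition_Cons)
    have y: "0 < y" "y \<le> x" using Cons Cons.prems by (auto simp: is_partition_Cons)
    have "map content (map (apfst Suc) (rim xs)) = map (\<lambda>z. z - 1) (map content (rim xs))"
      by (simp add: S o_def)
    also have "\<dots> = map (\<lambda>k. int x - 1 - int k) [x - lo xs..<x + length xs]"
      unfolding IH by (rule nth_equalityI) (use Cons y in \<open>auto simp del: upt_Suc\<close>)
    finally have "map content (rim (x # xs)) = map (\<lambda>k. int x - 1 - int k) ([0..<x - lo xs] @ [x - lo xs..<x + length xs])"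
      using A by (simp add: rim_Cons)
    also have "[0..<x - lo xs] @ [x - lo xs..<x + length xs] = [0..<x + length xs]"
      using upt_add_eq_append [of 0 "x - lo xs" "lo xs + length xs"] lo by simp
    finally show ?thesis by simp
  qed
qed simp

lemma length_rim: "is_partition l \<Longrightarrow> l \<noteq> [] \<Longrightarrow> length (rim l) = hd l + length l - 1"
  using arg_cong [OF content_rim, of l length] by simp

lemma content_rim_nth:
  assumes "is_partition l" "k < length (rim l)"
  shows "content (rim l ! k) = int (hd l) - 1 - int k"
proof -
  have "l \<noteq> []" using assms by auto
  then show ?thesis
    using arg_cong [OF content_rim, of l "\<lambda>xs. xs ! k"] assms length_rim by (simp add: nth_map)
qed

lemma distinct_rim: "distinct (rim l)"
  by (induction l) (auto simp: rim_Cons distinct_map inj_on_def apfst_def)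

section \<open>Rim hooks and cores\<close>

definition part :: "nat list \<Rightarrow> nat \<Rightarrow> nat" where
  "part l i = (if i < length l then l ! i else 0)"

definition ind :: "nat \<Rightarrow> int \<Rightarrow> int \<Rightarrow> int" where
  "ind p x c = of_bool (int p dvd x - c)"

text \<open>Counts the beta numbers \<open>part l i - i\<close> in the class of c. Zero rows are
  included up to a common \<open>n\<close>, so that partitions with different numbers of parts can
  be compared.\<close>

definition res_count :: "nat \<Rightarrow> nat \<Rightarrow> nat list \<Rightarrow> int \<Rightarrow> int" where
  "res_count p n l c = (\<Sum>i<n. ind p (int (part l i) - int i) c)"

lemma ind_cong: "int p dvd (x - c) - (y - d) \<Longrightarrow> ind p x c = ind p y d"
  using dvd_add_right_iff [of "int p" "(x - c) - (y - d)" "y - d"] by (simp add: ind_def)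

lemma diagram_Sigma: "length l \<le> n \<Longrightarrow> diagram l = (SIGMA i:{..<n}. {..<part l i})"
  by (auto simp: diagram_def part_def split: if_splits)

lemma finite_diagram [simp]: "finite (diagram l)"
  by (simp add: diagram_Sigma [OF order_refl])

lemma card_diagram: "card (diagram l) = sum_list l"
  by (simp add: diagram_Sigma [OF order_refl] part_def sum_list_sum_nth atLeast0LessThan)

text \<open>Along row i, the nodes of content c - 1 minus those of content c (modulo p) telescope to
  a comparison of the beta number with -i. Residue counts become differences of content counts,
  which do not change when one node of each class is removed.\<close>

lemma res_count_content:
  assumes "length l \<le> n"
  shows "res_count p n l c - res_count p n [] c
    = (\<Sum>x\<in>diagram l. ind p (content x) (c - 1)) - (\<Sum>x\<in>diagram l. ind p (content x) c)"
proof -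
  have row: "(\<Sum>j<L. ind p (int j - int i) (c - 1) - ind p (int j - int i) c)
      = ind p (int L - int i) c - ind p (- int i) c" for L i
  proof (induction L)
    case (Suc L)
    have "ind p (int L - int i) (c - 1) = ind p (int (Suc L) - int i) c"
      by (rule ind_cong) simp
    then show ?case using Suc by simp
  qed simp
  have D: "(\<Sum>x\<in>diagram l. ind p (content x) d) = (\<Sum>i<n. \<Sum>j<part l i. ind p (int j - int i) d)" for d
    by (simp add: diagram_Sigma [OF assms] sum.Sigma split_def content_def)
  have "(\<Sum>x\<in>diagram l. ind p (content x) (c - 1)) - (\<Sum>x\<in>diagram l. ind p (content x) c)
      = (\<Sum>i<n. ind p (int (part l i) - int i) c - ind p (- int i) c)"
    by (simp only: D row sum_subtractf [symmetric])
  then show ?thesis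
    by (simp add: res_count_def sum_subtractf part_def [of "[]"])
qed

lemma sum_ind_window:
  assumes "p > 0"
  shows "(\<Sum>y\<in>{t - int p<..t}. ind p y c) = 1"
proof -
  \<comment> \<open>The largest integer up to t congruent to c is the only one in the
    window.\<close>
  have "{y \<in> {t - int p<..t}. int p dvd y - c} = {t - (t - c) mod int p}"
  proof (intro equalityI subsetI)
    fix y assume y: "y \<in> {y \<in> {t - int p<..t}. int p dvd y - c}"
    have "(t - c) mod int p = ((t - y) + (y - c)) mod int p" by simp
    also have "\<dots> = (t - y) mod int p"
      using y by (metis (no_types, lifting) mem_Collect_eq mod_add_right_eq add.right_neutral dvd_imp_mod_0)
    also have "\<dots> = t - y" using y by simp
    finally show "y \<in> {t - (t - c) mod int p}" by simp
  next
    fix y assume y: "y \<in> {t - (t - c) mod int p}"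
    have "y - c = (t - c) - (t - c) mod int p" using y by simp
    then have "int p dvd y - c" by (metis dvd_minus_mod)
    moreover have "0 \<le> (t - c) mod int p" "(t - c) mod int p < int p" using assms by auto
    ultimately show "y \<in> {y \<in> {t - int p<..t}. int p dvd y - c}" using y by auto
  qed
  moreover have "(\<Sum>y\<in>{t - int p<..t}. ind p y c) = int (card {y \<in> {t - int p<..t}. int p dvd y - c})"
    by (simp add: ind_def sum_of_bool_eq Int_def)
  ultimately show ?thesis by simp
qed

text \<open>All that is kept of a hook is that its contents fill a window of p consecutive integers,
  by \<open>content_rim_nth\<close>; its place in the rim is forgotten.\<close>

lemma rim_hook_removalE:
  assumes "rim_hook_removal p l m"
  obtains H t where "H \<subseteq> diagram l" "diagram m = diagram l - H" "card H = p"
    "bij_betw content H {t - int p<..t}"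
proof -
  obtain xs h ys where *: "rim l = xs @ h @ ys" "length h = p" "diagram m = diagram l - set h"
    and l: "is_partition l"
    using assms by (auto simp: rim_hook_removal_def)
  define t where "t = int (hd l) - 1 - int (length xs)"
  have nth: "content (h ! k) = t - int k" if "k < p" for k
  proof -
    have "h ! k = rim l ! (length xs + k)" using * that by (simp add: nth_append)
    then show ?thesis using content_rim_nth [OF l, of "length xs + k"] * that by (simp add: t_def)
  qed
  have im: "content ` set h = {t - int p<..t}"
  proof (intro equalityI subsetI)
    fix y assume "y \<in> {t - int p<..t}"
    then have "nat (t - y) < p" "y = t - int (nat (t - y))" by auto
    then show "y \<in> content ` set h" using nth [of "nat (t - y)"] * by (metis image_eqI nth_mem)
  next
    fix y assume "y \<in> content ` set h"
    then obtain k where "k < p" "y = content (h ! k)" using * by (auto simp: in_set_conv_nth)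
    then show "y \<in> {t - int p<..t}" using nth by simp
  qed
  have d: "distinct h" using distinct_rim [of l] * by auto
  have c: "card (set h) = p" using d * distinct_card by blast
  have "bij_betw content (set h) {t - int p<..t}"
    unfolding bij_betw_def using im c by (auto intro!: eq_card_imp_inj_on)
  moreover have "set h \<subseteq> diagram l"
    using set_rim [of l] * by auto
  ultimately show thesis using that * c by blast
qed

lemma sum_list_rim_hook_removal: "rim_hook_removal p l m \<Longrightarrow> sum_list l = sum_list m + p"
proof (erule rim_hook_removalE)
  fix H t assume H: "H \<subseteq> diagram l" "diagram m = diagram l - H" "card H = p"
  then have "card (diagram m) = card (diagram l) - p" "p \<le> card (diagram l)"
    using card_Diff_subset [of H "diagram l"] card_mono [of "diagram l" H] finite_subset [of H "diagram l"] by auto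
  then show ?thesis by (simp add: card_diagram)
qed

lemma length_le_of_diagram_subset:
  assumes "is_partition m" "diagram m \<subseteq> diagram l"
  shows "length m \<le> length l"
proof (rule ccontr)
  assume "\<not> ?thesis"
  then have "length l < length m" by simp
  moreover from this have "0 < m ! length l" using assms(1) nth_mem [of "length l" m] by (metis gr0I is_partition_def)
  ultimately have "(length l, 0) \<in> diagram m" by (simp add: diagram_def)
  then show False using assms(2) by (auto simp: diagram_def)
qed

lemma length_rim_hook_removal: "rim_hook_removal p l m \<Longrightarrow> length m \<le> length l"
  by (rule length_le_of_diagram_subset) (auto simp: rim_hook_removal_def)

text \<open>A hook has exactly one node in each content class, so both content counts in
  \<open>res_count_content\<close> fall by one.\<close>

lemma res_count_rim_hook_removal:
  assumes "rim_hook_removal p l m" "length l \<le> n" "p > 0"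
  shows "res_count p n m c = res_count p n l c"
proof -
  obtain H t where H: "H \<subseteq> diagram l" "diagram m = diagram l - H"
    "bij_betw content H {t - int p<..t}"
    using rim_hook_removalE [OF assms(1)] by metis
  have "(\<Sum>x\<in>H. ind p (content x) d) = 1" for d
    using sum.reindex_bij_betw [OF H(3), of "\<lambda>y. ind p y d"] sum_ind_window [OF assms(3)] by simp
  then have "(\<Sum>x\<in>diagram m. ind p (content x) d) = (\<Sum>x\<in>diagram l. ind p (content x) d) - 1" for d
    using sum_diff [OF finite_diagram H(1), of "\<lambda>x. ind p (content x) d"] H(2) by simp
  then show ?thesis
    using res_count_content [of l n p c] res_count_content [of m n p c] assms length_rim_hook_removal [OF assms(1)]
    by simp
qed

lemma res_count_rtranclp:
  assumes "(rim_hook_removal p)\<^sup>*\<^sup>* l m" "length l \<le> n" "p > 0"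
  shows "res_count p n m c = res_count p n l c \<and> length m \<le> length l"
  using assms(1)
proof induction
  case (step y z)
  then show ?case
    using res_count_rim_hook_removal [of p y z n c] length_rim_hook_removal [of p y z] assms by auto
qed simp

text \<open>Row lengths after deleting the first \<open>c\<close> rim nodes.\<close>

fun trim :: "nat \<Rightarrow> nat list \<Rightarrow> nat list" where
  "trim c [] = []"
| "trim c (x # xs) = (if c \<le> x - lo xs then (x - c) # xs else lo xs # trim (c - (x - lo xs)) xs)"

lemma diagram_Nil [simp]: "diagram [] = {}"
  by (simp add: diagram_def)

lemma diagram_Cons: "diagram (x # xs) = Pair 0 ` {..<x} \<union> apfst Suc ` diagram xs"
proof -
  have "(i, j) \<in> diagram (x # xs) \<longleftrightarrow> (i, j) \<in> Pair 0 ` {..<x} \<union> apfst Suc ` diagram xs" for i j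
    by (cases i) (auto simp: diagram_def image_iff)
  then show ?thesis by auto
qed

lemma Diff_Un_Diff: "A \<inter> D = {} \<Longrightarrow> B \<inter> C = {} \<Longrightarrow> (A - B) \<union> (C - D) = (A \<union> C) - (B \<union> D)"
  by blast

lemma diagram_trim:
  "is_partition xs \<Longrightarrow> diagram (trim c xs) = diagram xs - set (take c (rim xs))"
proof (induction xs arbitrary: c)
  case (Cons x xs)
  have lo: "lo xs < x" using Cons.prems by (rule lo_less)
  show ?case
  proof (cases "c \<le> x - lo xs")
    case True
    then have "lo xs + (x - (lo xs + c)) = x - c" using lo by simp
    then have "take c (rim (x # xs)) = map (Pair 0) (rev [x - c..<x])"
      using True by (auto simp: rim_Cons take_map take_rev)
    then have "set (take c (rim (x # xs))) = Pair 0 ` {x - c..<x}" by simp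
    moreover have "Pair 0 ` {..<x - c} = Pair (0::nat) ` {..<x} - Pair 0 ` {x - c..<x}" by (auto simp: image_iff)
    moreover have "apfst Suc ` diagram xs - Pair 0 ` {x - c..<x} = apfst Suc ` diagram xs" by auto
    ultimately show ?thesis using True by (simp add: diagram_Cons Un_Diff)
  next
    case False
    then have tk: "take c (rim (x # xs)) = map (Pair 0) (rev [lo xs..<x]) @ map (apfst Suc) (take (c - (x - lo xs)) (rim xs))"
      by (auto simp: rim_Cons take_map)
    have IH: "diagram (trim (c - (x - lo xs)) xs) = diagram xs - set (take (c - (x - lo xs)) (rim xs))"
      using Cons by (simp add: is_partition_Cons)
    have "inj (apfst Suc :: nat \<times> nat \<Rightarrow> _)" by (auto simp: inj_def)
    then have "apfst Suc ` (diagram xs - set (take (c - (x - lo xs)) (rim xs)))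
        = apfst Suc ` diagram xs - apfst Suc ` set (take (c - (x - lo xs)) (rim xs))"
      by (rule image_set_diff)
    moreover have "Pair (0::nat) ` {..<lo xs} = Pair 0 ` {..<x} - Pair 0 ` {lo xs..<x}" using lo by (auto simp: image_iff)
    moreover have "Pair (0::nat) ` {..<x} \<inter> apfst Suc ` B = {}" "Pair (0::nat) ` {lo xs..<x} \<inter> apfst Suc ` B = {}"
      for B by auto
    ultimately have "diagram (lo xs # trim (c - (x - lo xs)) xs) = diagram (x # xs) -
        (Pair 0 ` {lo xs..<x} \<union> apfst Suc ` set (take (c - (x - lo xs)) (rim xs)))"
      unfolding diagram_Cons IH by (simp only: Diff_Un_Diff)
    then show ?thesis using False by (simp add: tk)
  qed
qed simp

text \<open>The row where the deletion stops keeps at least y - 1 nodes, y being the row below. The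
  order fails only for exactly y - 1, that is if the lowered beta number \<open>hd xs - c\<close>
  equals that of the row below. The strict drop of the head is carried along because the row above
  is cut to \<open>hd xs - 1\<close>.\<close>

lemma trim_sorted:
  assumes "is_partition xs" "xs \<noteq> []" "0 < c" "c < hd xs + length xs"
    "\<And>k. k < length xs \<Longrightarrow> int (hd xs) - int c \<noteq> int (xs ! k) - int k"
  shows "sorted_wrt (\<ge>) (trim c xs) \<and> hd (trim c xs) < hd xs"
  using assms
proof (induction xs arbitrary: c)
  case (Cons x xs)
  have lo: "lo xs < x" using Cons.prems by (simp add: lo_less)
  have xs: "is_partition xs" "\<And>y. y \<in> set xs \<Longrightarrow> y \<le> x" using Cons.prems by (auto simp: is_partition_Cons)
  show ?case
  proof (cases xs)
    case Nil
    then show ?thesis using Cons.prems by auto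
  next
    case xsC: (Cons y ys)
    have y: "0 < y" "y \<le> x" using xs xsC by (auto simp: is_partition_Cons)
    show ?thesis
    proof (cases "c \<le> x - lo xs")
      case True
      have "int x - int c \<noteq> int y - 1" using Cons.prems(5)[of 1] xsC by simp
      then have "y \<le> x - c" using True xsC y by simp
      moreover have "\<forall>z\<in>set ys. z \<le> y" using xs(1) xsC by (simp add: is_partition_Cons)
      ultimately show ?thesis using True xsC xs(1) lo Cons.prems by (auto simp: is_partition_def)
    next
      case False
      have hd: "hd xs = y" "lo xs = y - 1" using xsC by auto
      have "sorted_wrt (\<ge>) (trim (c - (x - lo xs)) xs) \<and> hd (trim (c - (x - lo xs)) xs) < hd xs"
      proof (rule Cons.IH)
        fix k assume "k < length xs"
        then show "int (hd xs) - int (c - (x - lo xs)) \<noteq> int (xs ! k) - int k"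
          using Cons.prems(5)[of "Suc k"] False hd y by auto
      qed (use xs xsC False Cons.prems hd y in auto)
      moreover have "trim (c - (x - lo xs)) xs \<noteq> []" using xsC by simp
      ultimately show ?thesis using False lo hd y
        by (cases "trim (c - (x - lo xs)) xs") auto
    qed
  qed
qed simp

lemma diagram_filter_pos: "sorted_wrt (\<ge>) l \<Longrightarrow> diagram (filter (\<lambda>x. 0 < x) l) = diagram l"
proof (induction l)
  case (Cons x l)
  show ?case
  proof (cases "x = 0")
    case True
    then have "filter (\<lambda>x. 0 < x) l = []" using Cons.prems by (auto simp: filter_empty_conv)
    then show ?thesis using True Cons by (auto simp: diagram_Cons)
  qed (use Cons in \<open>simp add: diagram_Cons\<close>)
qed simp

text \<open>The hook starting at the end of row i moves a beta number down by p. The fourth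
  assumption gives the rim at least p nodes from row i on, the fifth says that the new position is
  free. The bound on the head allows the rows above i to be put back.\<close>

lemma ex_rim_hook_at:
  assumes "is_partition l" "i < length l" "0 < p" "int (l ! i) - int i - int p > - int (length l)"
    "\<And>k. k < length l \<Longrightarrow> int (l ! i) - int i - int p \<noteq> int (l ! k) - int k"
  shows "\<exists>xs h ys l'. rim l = xs @ h @ ys \<and> length h = p \<and> diagram l' = diagram l - set h \<and>
           sorted_wrt (\<ge>) l' \<and> l' \<noteq> [] \<and> hd l' \<le> hd l"
  using assms
proof (induction l arbitrary: i)
  case (Cons x l)
  show ?case
  proof (cases i)
    case 0
    have "sorted_wrt (\<ge>) (trim p (x # l)) \<and> hd (trim p (x # l)) < hd (x # l)"
      by (rule trim_sorted) (use Cons.prems 0 in auto)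
    moreover have "rim (x # l) = [] @ take p (rim (x # l)) @ drop p (rim (x # l))" by simp
    moreover have "length (take p (rim (x # l))) = p"
      using length_rim [OF Cons.prems(1)] Cons.prems 0 by simp
    moreover have "trim p (x # l) \<noteq> []" by simp
    ultimately show ?thesis using diagram_trim [OF Cons.prems(1), of p] less_imp_le by blast
  next
    case (Suc i')
    have l: "is_partition l" "\<forall>y\<in>set l. y \<le> x" using Cons.prems by (auto simp: is_partition_Cons)
    have "\<exists>xs h ys l'. rim l = xs @ h @ ys \<and> length h = p \<and> diagram l' = diagram l - set h \<and>
           sorted_wrt (\<ge>) l' \<and> l' \<noteq> [] \<and> hd l' \<le> hd l"
    proof (rule Cons.IH)
      fix k assume "k < length l"
      then show "int (l ! i') - int i' - int p \<noteq> int (l ! k) - int k"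
        using Cons.prems(5)[of "Suc k"] Suc by auto
    qed (use l Suc Cons.prems in auto)
    then obtain xs h ys l' where *: "rim l = xs @ h @ ys" "length h = p" "diagram l' = diagram l - set h"
      "sorted_wrt (\<ge>) l'" "l' \<noteq> []" "hd l' \<le> hd l" by blast
    have "hd l \<le> x" using l Suc Cons.prems by (cases l) auto
    then have s: "sorted_wrt (\<ge>) (x # l')" using * by (cases l') auto
    have "inj (apfst Suc :: nat \<times> nat \<Rightarrow> _)" by (auto simp: inj_def)
    then have "diagram (x # l') = diagram (x # l) - set (map (apfst Suc) h)"
      by (auto simp: diagram_Cons *(3) image_set_diff)
    moreover have "rim (x # l) = (map (Pair 0) (rev [lo l..<x]) @ map (apfst Suc) xs) @ map (apfst Suc) h @ map (apfst Suc) ys"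
      by (simp add: rim_Cons *)
    ultimately show ?thesis using s *(2) by (metis length_map list.sel(1) list.distinct(1) order_refl)
  qed
qed simp

text \<open>A free position p below a beta number would permit a hook by
  \<open>ex_rim_hook_at\<close>. The bound is strict because -n is the first position below the beta
  numbers of n rows.\<close>

lemma terminal_closed:
  assumes "is_partition l" "\<nexists>m. rim_hook_removal p l m" "0 < p" "length l \<le> n" "i < n"
    "int (part l i) - int i - int p > - int n"
  shows "\<exists>k<n. int (part l i) - int i - int p = int (part l k) - int k"
proof (rule ccontr)
  assume neg: "\<not> ?thesis"
  \<comment> \<open>A padding row i has beta number -i, and -i - p belongs to the padding row i +
    p.\<close>
  have i: "i < length l"
  proof (rule ccontr)
    assume "\<not> i < length l"
    then show False using neg assms by (auto simp: part_def dest!: spec [of _ "i + p"])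
  qed
  \<comment> \<open>A position at or below minus the number of parts belongs to a padding
    row.\<close>
  have gt: "int (l ! i) - int i - int p > - int (length l)"
  proof (rule ccontr)
    assume "\<not> ?thesis"
    moreover define k where "k = nat (int i + int p - int (l ! i))"
    ultimately have "length l \<le> k" "int (l ! i) - int i - int p = - int k" by auto
    moreover from this have "k < n" using assms(6) i by (simp add: part_def)
    ultimately show False using neg i by (auto simp: part_def)
  qed
  have "int (l ! i) - int i - int p \<noteq> int (l ! k) - int k" if "k < length l" for k
    using neg that i assms(4) by (metis order_less_le_trans part_def)
  from ex_rim_hook_at [OF assms(1) i assms(3) gt this]
  obtain xs h ys l' where *: "rim l = xs @ h @ ys" "length h = p" "diagram l' = diagram l - set h"
    "sorted_wrt (\<ge>) l'" by blast
  have "rim_hook_removal p l (filter (\<lambda>x. 0 < x) l')"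
    unfolding rim_hook_removal_def diagram_filter_pos [OF *(4)]
    using * assms(1) by (auto simp: is_partition_def sorted_wrt_filter)
  then show False using assms(2) by blast
qed

section \<open>Beta sets and uniqueness of the core\<close>

definition betas :: "nat \<Rightarrow> nat list \<Rightarrow> int set" where
  "betas n l = (\<lambda>i. int (part l i) - int i) ` {..<n}"

lemma part_mono: "is_partition l \<Longrightarrow> i \<le> k \<Longrightarrow> part l k \<le> part l i"
  by (cases "i = k") (auto simp: part_def is_partition_def sorted_wrt_iff_nth_less)

lemma inj_beta: "is_partition l \<Longrightarrow> inj_on (\<lambda>i. int (part l i) - int i) A"
proof (rule linorder_inj_onI')
  fix i k :: nat assume "is_partition l" "i < k"
  then have "part l k \<le> part l i" by (simp add: part_mono)
  then show "int (part l i) - int i \<noteq> int (part l k) - int k" using \<open>i < k\<close> by simp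
qed

lemma res_count_betas: "is_partition l \<Longrightarrow> res_count p n l c = (\<Sum>b\<in>betas n l. ind p b c)"
  unfolding betas_def res_count_def by (subst sum.reindex [OF inj_beta]) auto

text \<open>In each residue class such a set consists of the lowest positions above N, so its
  cardinality determines it. If b is in F but not in G, all members of G in its class lie below b
  and hence in F, so G has fewer of them.\<close>

lemma closed_subset:
  fixes F G :: "int set"
  assumes fin: "finite F" "finite G" and p: "p > 0"
    and low: "\<And>b. b \<in> F \<Longrightarrow> b > N" "\<And>b. b \<in> G \<Longrightarrow> b > N"
    and clF: "\<And>b. b \<in> F \<Longrightarrow> b - int p > N \<Longrightarrow> b - int p \<in> F"
    and clG: "\<And>b. b \<in> G \<Longrightarrow> b - int p > N \<Longrightarrow> b - int p \<in> G"
    and cnt: "\<And>c. (\<Sum>b\<in>F. ind p b c) = (\<Sum>b\<in>G. ind p b c)"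
  shows "F \<subseteq> G"
proof
  fix b assume b: "b \<in> F"
  show "b \<in> G"
  proof (rule ccontr)
    assume nb: "b \<notin> G"
    have down: "x - int p * int k \<in> A" if "x \<in> A" "x - int p * int k > N"
      "\<And>b. b \<in> A \<Longrightarrow> b - int p > N \<Longrightarrow> b - int p \<in> A" for x k and A :: "int set"
      using that(2)
    proof (induction k)
      case (Suc k)
      have "int p * int k \<le> int p * int (Suc k)" by (simp add: algebra_simps)
      then have "x - int p * int k \<in> A" using Suc by linarith
      then show ?case using that(3)[of "x - int p * int k"] Suc.prems by (simp add: algebra_simps)
    qed (use that in simp)
    let ?F = "{x \<in> F. int p dvd x - b}" and ?G = "{x \<in> G. int p dvd x - b}"
    have "?G \<subseteq> ?F"
    proof
      fix x assume x: "x \<in> ?G"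
      then obtain k where k: "x - b = int p * k" by auto
      have "k < 0"
      proof (rule ccontr)
        assume "\<not> k < 0"
        then have "b = x - int p * int (nat k)" using k by simp
        then show False using down [of x G "nat k"] clG x nb low(1) [OF b] by auto
      qed
      then have "x = b - int p * int (nat (- k))" using k by simp
      then show "x \<in> ?F" using down [of b F "nat (- k)"] clF b low(2)[of x] x by auto
    qed
    moreover have "b \<in> ?F" "b \<notin> ?G" using b nb by auto
    ultimately have "card ?G < card ?F" using fin by (intro psubset_card_mono) auto
    moreover have "(\<Sum>x\<in>A. ind p x b) = int (card {x \<in> A. int p dvd x - b})" if "finite A" for A
      using that by (simp add: ind_def sum_of_bool_eq Int_def)
    ultimately show False using cnt [of b] fin by simp
  qed
qed

lemma partition_eq_parts: "is_partition l \<Longrightarrow> length l \<le> n \<Longrightarrow> l = filter (\<lambda>x. 0 < x) (map (part l) [0..<n])"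
proof -
  assume l: "is_partition l" "length l \<le> n"
  have "[0..<n] = [0..<length l] @ [length l..<n]"
    using upt_add_eq_append [of 0 "length l" "n - length l"] l by simp
  moreover have "filter (\<lambda>x. 0 < x) (map (part l) [length l..<n]) = []"
    by (auto simp: filter_empty_conv part_def)
  moreover have "map (part l) [0..<length l] = l"
    by (rule nth_equalityI) (auto simp: part_def)
  moreover have "filter (\<lambda>x. 0 < x) l = l"
    using l by (auto simp: is_partition_def filter_id_conv intro: gr0I)
  ultimately show ?thesis by simp
qed

text \<open>Beta numbers strictly decrease along the rows, so their set determines their sequence,
  and dropping the zero rows recovers the parts.\<close>

lemma betas_inject:
  assumes "is_partition l" "is_partition m" "length l \<le> n" "length m \<le> n" "betas n l = betas n m"
  shows "l = m"
proof -
  let ?f = "\<lambda>l. map (\<lambda>i. int (part l i) - int i) [0..<n]"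
  have sorted: "sorted (rev (?f l))" if "is_partition l" for l
  proof -
    have "int (part l k) - int k \<le> int (part l i) - int i" if "i < k" for i k
      using part_mono [OF \<open>is_partition l\<close>, of i k] that by simp
    then show ?thesis unfolding sorted_wrt_rev by (simp add: sorted_wrt_iff_nth_less)
  qed
  have dist: "distinct (rev (?f l))" if "is_partition l" for l
    using inj_beta [OF that] by (simp add: distinct_map)
  have "set (rev (?f l)) = set (rev (?f m))"
    using assms(5) by (simp add: betas_def atLeast0LessThan)
  then have "rev (?f l) = rev (?f m)"
    using sorted_distinct_set_unique sorted dist assms by blast
  then have "?f l = ?f m" by simp
  then have "\<forall>i<n. int (part l i) - int i = int (part m i) - int i"
    by simp
  then have "map (part l) [0..<n] = map (part m) [0..<n]" by auto
  then show ?thesis using assms partition_eq_parts by metis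
qed

lemma terminal_unique:
  assumes "is_partition l" "is_partition m" "\<nexists>k. rim_hook_removal p l k" "\<nexists>k. rim_hook_removal p m k"
    "length l \<le> n" "length m \<le> n" "p > 0" "\<And>c. res_count p n l c = res_count p n m c"
  shows "l = m"
proof (rule betas_inject)
  have low: "b > - int n" if "b \<in> betas n l" for b l
    using that by (auto simp: betas_def)
  have cl: "b - int p \<in> betas n l"
    if "is_partition l" "\<nexists>k. rim_hook_removal p l k" "length l \<le> n" "b \<in> betas n l" "b - int p > - int n" for b l
    using that terminal_closed [OF that(1,2) assms(7) that(3)] unfolding betas_def by (auto simp: image_iff)
  have fin: "finite (betas n l)" for l by (simp add: betas_def)
  show "betas n l = betas n m"
  proof (rule equalityI)
    show "betas n l \<subseteq> betas n m"
      by (rule closed_subset [where N = "- int n" and p = p])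
        (use assms low cl fin in \<open>auto simp: res_count_betas [symmetric]\<close>)
    show "betas n m \<subseteq> betas n l"
      by (rule closed_subset [where N = "- int n" and p = p])
        (use assms low cl fin in \<open>auto simp: res_count_betas [symmetric]\<close>)
  qed
qed (use assms in auto)

lemma ex_terminal:
  assumes "p > 0"
  shows "\<exists>m. (rim_hook_removal p)\<^sup>*\<^sup>* l m \<and> (\<nexists>n. rim_hook_removal p m n)"
proof (induction "sum_list l" arbitrary: l rule: less_induct)
  case less
  show ?case
  proof (cases "\<exists>n. rim_hook_removal p l n")
    case True
    then obtain n where n: "rim_hook_removal p l n" by blast
    then have "sum_list n < sum_list l" using sum_list_rim_hook_removal assms by fastforce
    from less [OF this] show ?thesis using n by (meson converse_rtranclp_into_rtranclp)
  qed blast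
qed

lemma rtranclp_is_partition: "(rim_hook_removal p)\<^sup>*\<^sup>* l m \<Longrightarrow> is_partition l \<Longrightarrow> is_partition m"
  by (induction rule: rtranclp_induct) (auto simp: rim_hook_removal_def)

text \<open>Stated for an arbitrary terminal \<open>m'\<close>, so that it shows both that the
  \<open>THE\<close> in \<open>p_core\<close> is well defined and, in \<open>p_core_eqI\<close>,
  what its value is.\<close>

lemma p_core_unique:
  assumes "p > 0" "is_partition l" "is_partition m" "\<nexists>k. rim_hook_removal p m k"
    "length l \<le> n" "length m \<le> n" "\<And>c. res_count p n l c = res_count p n m c"
    "(rim_hook_removal p)\<^sup>*\<^sup>* l m'" "\<nexists>k. rim_hook_removal p m' k"
  shows "m' = m"
proof (rule terminal_unique)
  show "is_partition m'" using assms(2,8) rtranclp_is_partition by blast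
  have "\<And>c. res_count p n m' c = res_count p n l c \<and> length m' \<le> length l"
    using res_count_rtranclp [OF assms(8) assms(5) assms(1)] by simp
  then show "length m' \<le> n" "\<And>c. res_count p n m' c = res_count p n m c"
    using assms(5,7) by (force, simp)
qed (use assms in auto)

lemma p_core_props:
  assumes "p > 0" "is_partition l"
  shows "(rim_hook_removal p)\<^sup>*\<^sup>* l (p_core p l)" "\<nexists>n. rim_hook_removal p (p_core p l) n"
proof -
  let ?P = "\<lambda>m. (rim_hook_removal p)\<^sup>*\<^sup>* l m \<and> (\<nexists>n. rim_hook_removal p m n)"
  obtain m where m: "?P m" using ex_terminal [OF assms(1)] by blast
  have "m' = m" if "?P m'" for m'
  proof (rule p_core_unique [OF assms, of m "length l"])
    show "is_partition m" using m assms rtranclp_is_partition by blast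
    fix c
    have *: "res_count p (length l) m c = res_count p (length l) l c \<and> length m \<le> length l"
      using res_count_rtranclp m assms(1) by blast
    then show "res_count p (length l) l c = res_count p (length l) m c" by simp
    from * show "length m \<le> length l" by simp
  qed (use m that in auto)
  then have "\<exists>!m. ?P m" using m by blast
  from theI' [OF this] show "(rim_hook_removal p)\<^sup>*\<^sup>* l (p_core p l)" "\<nexists>n. rim_hook_removal p (p_core p l) n"
    unfolding p_core_def by auto
qed

lemma p_core_eqI:
  assumes "p > 0" "is_partition l" "is_partition m" "\<nexists>k. rim_hook_removal p m k"
    "length l \<le> n" "length m \<le> n" "\<And>c. res_count p n l c = res_count p n m c"
  shows "p_core p l = m"
  by (rule p_core_unique [OF assms p_core_props [OF assms(1,2)]])

section \<open>Mullineux symbols\<close>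

text \<open>
  Row lengths after deleting the \<open>p\<close>-rim, where the current \<open>p\<close>-segment still has \<open>c\<close> nodes to go;
  emptied rows are kept as zeros.
\<close>

fun strip :: "nat \<Rightarrow> nat \<Rightarrow> nat list \<Rightarrow> nat list" where
  "strip p c [] = []"
| "strip p c (x # xs) = (if c \<le> x - lo xs then (x - c) # strip p p xs
     else lo xs # strip p (c - (x - lo xs)) xs)"

text \<open>Generalises the p-rim to a first segment with only c nodes to go, the situation in which
  a recursion over rows reaches the next row.\<close>

definition seg_nodes :: "nat \<Rightarrow> nat \<Rightarrow> (nat \<times> nat) list \<Rightarrow> (nat \<times> nat) set" where
  "seg_nodes p c xs = set (take c xs) \<union>
     set (concat (p_segments p (filter (\<lambda>n. fst (last (take c xs)) < fst n) xs)))"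

lemma p_segments_Nil [simp]: "p_segments p [] = []"
  by (simp add: p_segments.simps)

lemma seg_nodes_Nil [simp]: "seg_nodes p c [] = {}"
  by (simp add: seg_nodes_def)

lemma set_p_segments: "p > 0 \<Longrightarrow> set (concat (p_segments p xs)) = seg_nodes p p xs"
  by (subst p_segments.simps) (auto simp: seg_nodes_def Let_def)

lemma p_rim_seg_nodes: "p > 0 \<Longrightarrow> p_rim p l = seg_nodes p p (rim l)"
  by (simp add: p_rim_def set_p_segments del: set_concat)

lemma set_p_segments_subset: "set (concat (p_segments p xs)) \<subseteq> set xs"
proof (induction p xs rule: p_segments.induct)
  case (1 p xs)
  show ?case
  proof (cases "p = 0 \<or> xs = []")
    case False
    have "set (concat (p_segments p (filter (\<lambda>n. fst (last (take p xs)) < fst n) xs))) \<subseteq> set xs"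
      using 1 [OF False refl] by auto
    moreover have "set (take p xs) \<subseteq> set xs" by (rule set_take_subset)
    ultimately show ?thesis
      using False by (subst p_segments.simps) (auto simp: Let_def)
  qed (auto simp: p_segments.simps)
qed

lemma p_rim_subset: "p_rim p l \<subseteq> set (rim l)"
  unfolding p_rim_def by (rule set_p_segments_subset)

lemma p_segments_shift: "p_segments p (map (apfst Suc) xs) = map (map (apfst Suc)) (p_segments p xs)"
proof (induction p xs rule: p_segments.induct)
  case (1 p xs)
  show ?case
  proof (cases "p = 0 \<or> xs = []")
    case False
    then have "last (take p (map (apfst Suc) xs)) = apfst Suc (last (take p xs))"
      by (simp add: take_map last_map)
    then have "filter (\<lambda>n. fst (last (take p (map (apfst Suc) xs))) < fst n) (map (apfst Suc) xs)
       = map (apfst Suc) (filter (\<lambda>n. fst (last (take p xs)) < fst n) xs)"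
      by (simp add: filter_map o_def)
    then show ?thesis
      using False 1 [OF False refl]
      by (simp add: p_segments.simps [of p "map (apfst Suc) xs"] p_segments.simps [of p xs] Let_def take_map)
  qed (auto simp: p_segments.simps)
qed

text \<open>If the current segment ends in row 0, a new one of p nodes starts in row 1; otherwise
  all rim nodes of row 0 are used up and the segment continues below.\<close>

lemma seg_nodes_Cons:
  assumes "is_partition (x # xs)" "c > 0" "p > 0"
  shows "seg_nodes p c (rim (x # xs)) =
    (if c \<le> x - lo xs then Pair 0 ` {x - c..<x} \<union> apfst Suc ` seg_nodes p p (rim xs)
     else Pair 0 ` {lo xs..<x} \<union> apfst Suc ` seg_nodes p (c - (x - lo xs)) (rim xs))"
proof -
  have lo: "lo xs < x" using assms(1) by (rule lo_less)
  have im: "set (concat (map (map f) ss)) = f ` set (concat ss)" for f :: "nat \<times> nat \<Rightarrow> nat \<times> nat" and ss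
    by (metis map_concat set_map)
  show ?thesis
  proof (cases "c \<le> x - lo xs")
    case True
    then have "lo xs + (x - (lo xs + c)) = x - c" using lo by simp
    then have tk: "take c (rim (x # xs)) = map (Pair 0) (rev [x - c..<x])"
      using True by (auto simp: rim_Cons take_map take_rev)
    have "[x - c..<x] \<noteq> []" using assms lo by auto
    then have "fst (last (take c (rim (x # xs)))) = 0"
      unfolding tk by (subst last_map) auto
    moreover have "filter (\<lambda>n. 0 < fst n) (rim (x # xs)) = map (apfst Suc) (rim xs)"
      by (simp add: rim_Cons filter_map o_def)
    ultimately have "set (concat (p_segments p (filter (\<lambda>n. fst (last (take c (rim (x # xs)))) < fst n) (rim (x # xs)))))
       = apfst Suc ` seg_nodes p p (rim xs)"
      by (simp add: p_segments_shift im set_p_segments [OF assms(3)] del: set_concat)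
    then show ?thesis using True tk
      unfolding seg_nodes_def [of p c "rim (x # xs)"] by simp
  next
    case False
    define c' where "c' = c - (x - lo xs)"
    have c': "c' > 0" using False by (simp add: c'_def)
    have tk: "take c (rim (x # xs)) = map (Pair 0) (rev [lo xs..<x]) @ map (apfst Suc) (take c' (rim xs))"
      using False by (auto simp: rim_Cons take_map c'_def)
    show ?thesis
    proof (cases "xs = []")
      case True
      have "[0..<x] \<noteq> []" using lo by auto
      then have "fst (last (map (Pair (0::nat)) (rev [0..<x]))) = 0"
        by (subst last_map) auto
      then show ?thesis
        using False True by (simp add: seg_nodes_def tk rim_Cons)
    next
      case ne: False
      have "rim xs \<noteq> []"
        using ne assms length_rim [of xs] by (cases xs) (auto simp: is_partition_Cons)
      then have "last (take c (rim (x # xs))) = apfst Suc (last (take c' (rim xs)))"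
        unfolding tk using c' by (simp add: last_map)
      then have "filter (\<lambda>n. fst (last (take c (rim (x # xs)))) < fst n) (rim (x # xs))
         = map (apfst Suc) (filter (\<lambda>n. fst (last (take c' (rim xs))) < fst n) (rim xs))"
        by (simp add: rim_Cons filter_map o_def)
      then have "set (concat (p_segments p (filter (\<lambda>n. fst (last (take c (rim (x # xs)))) < fst n) (rim (x # xs)))))
         = apfst Suc ` set (concat (p_segments p (filter (\<lambda>n. fst (last (take c' (rim xs))) < fst n) (rim xs))))"
        by (simp add: p_segments_shift im del: set_concat)
      then show ?thesis using False
        unfolding seg_nodes_def c'_def [symmetric] by (simp add: tk image_Un Un_assoc del: set_concat)
    qed
  qed
qed

lemma diagram_strip:
  "is_partition l \<Longrightarrow> c > 0 \<Longrightarrow> p > 0 \<Longrightarrow> diagram (strip p c l) = diagram l - seg_nodes p c (rim l)"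
proof (induction l arbitrary: c)
  case (Cons x xs)
  have lo: "lo xs < x" using Cons.prems(1) by (rule lo_less)
  define b where "b = (if c \<le> x - lo xs then x - c else lo xs)"
  define d where "d = (if c \<le> x - lo xs then p else c - (x - lo xs))"
  have b: "b < x" using lo Cons.prems by (auto simp: b_def)
  have IH: "diagram (strip p d xs) = diagram xs - seg_nodes p d (rim xs)"
    using Cons by (auto simp: is_partition_Cons d_def)
  have s: "strip p c (x # xs) = b # strip p d xs" by (simp add: b_def d_def)
  have n: "seg_nodes p c (rim (x # xs)) = Pair 0 ` {b..<x} \<union> apfst Suc ` seg_nodes p d (rim xs)"
    using seg_nodes_Cons [OF Cons.prems] by (simp add: b_def d_def)
  have "inj (apfst Suc :: nat \<times> nat \<Rightarrow> _)" by (auto simp: inj_def)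
  then have "apfst Suc ` (diagram xs - seg_nodes p d (rim xs))
      = apfst Suc ` diagram xs - apfst Suc ` seg_nodes p d (rim xs)"
    by (rule image_set_diff)
  moreover have "Pair (0::nat) ` {..<b} = Pair 0 ` {..<x} - Pair 0 ` {b..<x}" using b by (auto simp: image_iff)
  moreover have "Pair (0::nat) ` {..<x} \<inter> apfst Suc ` B = {}" "Pair (0::nat) ` {b..<x} \<inter> apfst Suc ` B = {}"
    for B by auto
  ultimately show ?case
    unfolding s n diagram_Cons IH by (simp only: Diff_Un_Diff)
qed simp

lemma length_strip [simp]: "length (strip p c l) = length l"
  by (induction l arbitrary: c) auto

lemma diagram_strip_p_rim: "is_partition l \<Longrightarrow> p > 0 \<Longrightarrow> diagram (strip p p l) = diagram l - p_rim p l"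
  by (simp add: p_rim_seg_nodes diagram_strip)

lemma remove_p_rim_strip:
  assumes "is_partition l" "p > 0"
  shows "remove_p_rim p l = filter (\<lambda>x. 0 < x) (strip p p l)"
proof -
  have "{j. (i, j) \<in> diagram (strip p p l)} = {..<strip p p l ! i}" if "i < length l" for i
    using that by (auto simp: diagram_def)
  then have "map (\<lambda>i. card {j. (i, j) \<in> diagram l - p_rim p l}) [0..<length l] = strip p p l"
    unfolding diagram_strip_p_rim [OF assms, symmetric] by (intro nth_equalityI) auto
  then show ?thesis by (simp add: remove_p_rim_def)
qed

lemma p_rim_diagram: "p_rim p l \<subseteq> diagram l"
  using p_rim_subset [of p l] unfolding set_rim by blast

lemma card_p_rim:
  assumes "is_partition l" "p > 0"
  shows "card (p_rim p l) + sum_list (strip p p l) = sum_list l"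
proof -
  have "finite (p_rim p l)" using p_rim_diagram finite_diagram finite_subset by blast
  then have "card (p_rim p l) + card (diagram l - p_rim p l) = card (diagram l)"
    using p_rim_diagram [of p l] by (simp add: card_Diff_subset card_mono)
  then show ?thesis by (simp only: diagram_strip_p_rim [OF assms, symmetric] card_diagram)
qed

text \<open>A stripped row keeps at least \<open>lo xs\<close> nodes, while the row below loses a
  node and so drops to at most \<open>lo xs\<close>. The strict drop of the head is this second half
  of the induction.\<close>

lemma strip_sorted:
  "is_partition l \<Longrightarrow> l \<noteq> [] \<Longrightarrow> c > 0 \<Longrightarrow> p > 0 \<Longrightarrow>
     sorted_wrt (\<ge>) (strip p c l) \<and> hd (strip p c l) < hd l"
proof (induction l arbitrary: c)
  case (Cons x xs)
  have lo: "lo xs < x" using Cons.prems by (simp add: lo_less)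
  define b where "b = (if c \<le> x - lo xs then x - c else lo xs)"
  define d where "d = (if c \<le> x - lo xs then p else c - (x - lo xs))"
  have b: "b < x" "lo xs \<le> b" using lo Cons.prems by (auto simp: b_def)
  have s: "strip p c (x # xs) = b # strip p d xs" by (simp add: b_def d_def)
  show ?case
  proof (cases xs)
    case Nil
    then show ?thesis using s b by simp
  next
    case (Cons y ys)
    have "sorted_wrt (\<ge>) (strip p d xs) \<and> hd (strip p d xs) < hd xs"
      using Cons.prems \<open>xs = y # ys\<close> by (intro Cons.IH) (auto simp: is_partition_Cons d_def)
    moreover obtain z zs where "strip p d xs = z # zs"
      using Cons by (metis length_strip length_Suc_conv length_Cons)
    ultimately show ?thesis using s b Cons by (auto simp del: strip.simps)
  qed
qed simp

lemma is_partition_filter_pos: "sorted_wrt (\<ge>) l \<Longrightarrow> is_partition (filter (\<lambda>x. 0 < x) l)"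
  by (auto simp: is_partition_def sorted_wrt_filter)

lemma is_partition_strip: "is_partition l \<Longrightarrow> p > 0 \<Longrightarrow> is_partition (filter (\<lambda>x. 0 < x) (strip p p l))"
  using strip_sorted [of l p p] by (cases "l = []") (auto intro: is_partition_filter_pos)

lemma mullineux_symbol_strip:
  assumes "is_partition l" "p > 0" "l \<noteq> []"
  shows "mullineux_symbol p l =
    (sum_list l - sum_list (strip p p l), length l) # mullineux_symbol p (filter (\<lambda>x. 0 < x) (strip p p l))"
  using assms card_p_rim [OF assms(1,2)]
  by (simp add: mullineux_symbol.simps [of p l] remove_p_rim_strip flip: card_p_rim [OF assms(1,2)])

lemma mullineux_symbol_Nil [simp]: "mullineux_symbol p [] = []"
  by (simp add: mullineux_symbol.simps)

text \<open>
  The rows are recovered from the bottom up. A row determines only \<open>hd xs - c\<close>; whether it starts a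
  new segment, that is \<open>c = p\<close>, is read off the next row above. The congruence tells where the
  last segment stops.
\<close>

lemma strip_inject:
  assumes "is_partition xs" "is_partition ys" "length xs = length ys" "xs \<noteq> []"
    "0 < c" "c \<le> p" "0 < d" "d \<le> p" "strip p c xs = strip p d ys"
    "int p dvd (int (sum_list xs) + int d) - (int (sum_list ys) + int c)"
  shows "tl xs = tl ys \<and> hd xs + d = hd ys + c"
  using assms
proof (induction xs arbitrary: c ys d)
  case (Cons x xs)
  obtain y ys' where ys: "ys = y # ys'" using Cons.prems(3) by (cases ys) auto
  have lo: "lo xs < x" "lo ys' < y" using Cons.prems ys by (simp_all add: lo_less)
  define c1 where "c1 = (if c \<le> x - lo xs then p else c - (x - lo xs))"
  define d1 where "d1 = (if d \<le> y - lo ys' then p else d - (y - lo ys'))"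
  define s where "s = (if c \<le> x - lo xs then x - c else lo xs)"
  have sx: "strip p c (x # xs) = s # strip p c1 xs" by (simp add: s_def c1_def)
  have "strip p d ys = (if d \<le> y - lo ys' then y - d else lo ys') # strip p d1 ys'" by (simp add: ys d1_def)
  then have s': "s = (if d \<le> y - lo ys' then y - d else lo ys')" and tl: "strip p c1 xs = strip p d1 ys'"
    using Cons.prems(9) sx by auto
  have c1: "0 < c1" "c1 \<le> p" "0 < d1" "d1 \<le> p" using Cons.prems by (auto simp: c1_def d1_def)
  \<comment> \<open>\<open>c1 = p\<close> records that the segment ends in this row; otherwise the
    row is cut to exactly \<open>lo xs\<close> and \<open>c1\<close> nodes are still to go.\<close>
  have fx: "c1 = p \<and> x = s + c \<and> lo xs \<le> s \<or> c1 < p \<and> s = lo xs \<and> x + c1 = c + s"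
    using lo Cons.prems by (auto simp: c1_def s_def)
  have fy: "d1 = p \<and> y = s + d \<and> lo ys' \<le> s \<or> d1 < p \<and> s = lo ys' \<and> y + d1 = d + s"
    using lo Cons.prems unfolding s' by (auto simp: d1_def)
  \<comment> \<open>In both cases the number x - s of deleted nodes is congruent to c - c1, so the
    congruence passes to the rows below.\<close>
  have "int x + int c1 - int c - int s = 0 \<or> int x + int c1 - int c - int s = int p"
    "int y + int d1 - int d - int s = 0 \<or> int y + int d1 - int d - int s = int p"
    using fx fy by auto
  then have h: "int p dvd int x + int c1 - int c - int s" "int p dvd int y + int d1 - int d - int s"
    by auto
  have "int p dvd ((int (sum_list (x # xs)) + int d) - (int (sum_list ys) + int c))
      - (int x + int c1 - int c - int s) + (int y + int d1 - int d - int s)"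
    by (rule dvd_add [OF dvd_diff [OF Cons.prems(10) h(1)] h(2)])
  then have dvd: "int p dvd (int (sum_list xs) + int d1) - (int (sum_list ys') + int c1)"
    by (simp add: ys algebra_simps)
  show ?case
  proof (cases "xs = []")
    case True
    then have "ys' = []" using Cons.prems ys by simp
    \<comment> \<open>At the bottom, \<open>c1\<close> and \<open>d1\<close> are congruent modulo p
      and both lie in 1..p, hence agree.\<close>
    with True have "int p dvd int d1 - int c1" using dvd by simp
    moreover have "\<bar>int d1 - int c1\<bar> < int p" using c1 by auto
    ultimately have "int d1 - int c1 = 0" using dvd_imp_le_int [of "int d1 - int c1" "int p"] by linarith
    then have "d1 = c1" by simp
    then show ?thesis using True \<open>ys' = []\<close> ys fx fy by auto
  next
    case False
    have "tl xs = tl ys' \<and> hd xs + d1 = hd ys' + c1"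
      using Cons.prems ys False c1 tl dvd by (intro Cons.IH) (auto simp: is_partition_Cons)
    moreover obtain u xs1 where xs1: "xs = u # xs1" using False by (cases xs) auto
    moreover obtain v ys1 where ys1: "ys' = v # ys1"
      using Cons.prems ys False by (cases ys') auto
    moreover have "0 < u" "0 < v" using Cons.prems ys xs1 ys1 by (auto simp: is_partition_Cons)
    ultimately show ?thesis using fx fy ys by auto
  qed
qed simp

lemma sorted_filter_pos:
  fixes l :: "nat list"
  shows "sorted_wrt (\<ge>) l \<Longrightarrow>
    filter (\<lambda>x. 0 < x) l @ replicate (length l - length (filter (\<lambda>x. 0 < x) l)) 0 = l"
proof (induction l)
  case (Cons x l)
  show ?case
  proof (cases "x = 0")
    case True
    then have z: "\<forall>y\<in>set l. y = 0" using Cons.prems by auto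
    then have "filter (\<lambda>x. 0 < x) l = []" by (auto simp: filter_empty_conv)
    then show ?thesis using True z by (simp add: replicate_length_same)
  qed (use Cons in simp)
qed simp

text \<open>By induction on the number of columns the stripped partitions agree up to zeros. The
  numbers of parts fix the zeros, the sizes of the p-rims fix the sums, and
  \<open>strip_inject\<close> with c = d = p restores the rows.\<close>

lemma mullineux_symbol_inject:
  assumes "p > 0" "is_partition l" "is_partition m" "mullineux_symbol p l = mullineux_symbol p m"
  shows "l = m"
  using assms
proof (induction "length (mullineux_symbol p l)" arbitrary: l m)
  case 0
  then show ?case by (cases "l = []"; cases "m = []") (auto simp: mullineux_symbol_strip)
next
  case (Suc n)
  have ne: "l \<noteq> []" "m \<noteq> []" using Suc by auto
  note L = mullineux_symbol_strip [OF \<open>is_partition l\<close> \<open>p > 0\<close> ne(1)]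
  note M = mullineux_symbol_strip [OF \<open>is_partition m\<close> \<open>p > 0\<close> ne(2)]
  have eq: "filter (\<lambda>x. 0 < x) (strip p p l) = filter (\<lambda>x. 0 < x) (strip p p m)"
    using Suc.hyps(2) Suc.prems L M is_partition_strip by (intro Suc.hyps(1)) auto
  have len: "length l = length m" using Suc.prems L M by simp
  have st: "strip p p l = strip p p m"
    using sorted_filter_pos [of "strip p p l"] sorted_filter_pos [of "strip p p m"] eq len
      strip_sorted [of l p p] strip_sorted [of m p p] Suc.prems ne by simp
  have "sum_list l - sum_list (strip p p m) = sum_list m - sum_list (strip p p m)"
    using Suc.prems L M st by simp
  then have "sum_list l = sum_list m"
    using card_p_rim [OF \<open>is_partition l\<close> \<open>p > 0\<close>, unfolded st] card_p_rim [OF \<open>is_partition m\<close> \<open>p > 0\<close>]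
    by linarith
  then have "tl l = tl m \<and> hd l + p = hd m + p"
    using Suc.prems len ne st by (intro strip_inject) auto
  then show ?case using ne by (simp add: list.expand)
qed

text \<open>The uniqueness demanded by \<open>mullineux_map\<close> comes from
  \<open>mullineux_symbol_inject\<close>.\<close>

lemma mullineux_fixedI:
  assumes "p > 0" "p_regular p l" "mullineux_conj_symbol p (mullineux_symbol p l) = mullineux_symbol p l"
  shows "mullineux_fixed p l"
proof -
  let ?P = "\<lambda>m. p_regular p m \<and> mullineux_symbol p m = mullineux_conj_symbol p (mullineux_symbol p l)"
  have P: "?P l" using assms by simp
  moreover have "m = l" if "?P m" for m
    using mullineux_symbol_inject [OF assms(1)] that assms by (simp add: p_regular_def)
  ultimately have "\<exists>!m. ?P m" by blast
  then show ?thesis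
    using the1_equality [of ?P l] P by (auto simp: mullineux_fixed_def mullineux_map_def Let_def)
qed

lemma mullineux_fixedD:
  assumes "mullineux_fixed p l"
  shows "mullineux_conj_symbol p (mullineux_symbol p l) = mullineux_symbol p l"
proof -
  let ?P = "\<lambda>m. p_regular p m \<and> mullineux_symbol p m = mullineux_conj_symbol p (mullineux_symbol p l)"
  have ex: "\<exists>!m. ?P m" and "(THE m. ?P m) = l"
    using assms by (auto simp: mullineux_fixed_def mullineux_map_def Let_def split: if_splits)
  with theI' [OF ex] show ?thesis by simp
qed

section \<open>JS-partitions\<close>

definition expand :: "(nat \<times> nat) list \<Rightarrow> nat list" where
  "expand bs = concat (map (\<lambda>(v, a). replicate a v) bs)"

definition blocks :: "(nat \<times> nat) list \<Rightarrow> bool" where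
  "blocks bs \<longleftrightarrow> sorted_wrt (>) (map fst bs) \<and> (\<forall>b\<in>set bs. 0 < snd b)"

lemma expand_Nil [simp]: "expand [] = []"
  by (simp add: expand_def)

lemma expand_Cons [simp]: "expand ((v, a) # bs) = replicate a v @ expand bs"
  by (simp add: expand_def)

lemma blocks_Nil [simp]: "blocks []"
  by (simp add: blocks_def)

lemma blocks_Cons: "blocks ((v, a) # bs) \<longleftrightarrow> 0 < a \<and> (\<forall>b\<in>set bs. fst b < v) \<and> blocks bs"
  by (auto simp: blocks_def)

lemma set_expand: "blocks bs \<Longrightarrow> set (expand bs) = fst ` set bs"
  by (induction bs) (force simp: blocks_Cons)+

lemma remdups_adj_replicate_append:
  "0 < a \<Longrightarrow> v \<notin> set xs \<Longrightarrow> remdups_adj (replicate a v @ xs) = v # remdups_adj xs"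
proof (induction a)
  case (Suc a)
  then show ?case by (cases a; cases xs) auto
qed simp

lemma remdups_adj_expand: "blocks bs \<Longrightarrow> remdups_adj (expand bs) = map fst bs"
proof (induction bs)
  case (Cons b bs)
  obtain v a where b: "b = (v, a)" by (cases b)
  have "v \<notin> set (expand bs)" using Cons.prems by (auto simp: b blocks_Cons set_expand)
  then show ?case using Cons by (simp add: b blocks_Cons remdups_adj_replicate_append)
qed simp

lemma count_list_expand: "blocks bs \<Longrightarrow> b \<in> set bs \<Longrightarrow> count_list (expand bs) (fst b) = snd b"
proof (induction bs)
  case (Cons b' bs)
  obtain v a where b': "b' = (v, a)" by (cases b')
  have rep: "count_list (replicate n x) y = (if x = y then n else 0)" for n and x y :: nat
    by (induction n) auto
  have bs: "blocks bs" "v \<notin> set (expand bs)" using Cons.prems by (auto simp: b' blocks_Cons set_expand)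
  show ?case
  proof (cases "b = b'")
    case True
    then show ?thesis using bs by (simp add: b' rep count_list_0_iff)
  next
    case False
    then have "b \<in> set bs" using Cons.prems by simp
    then show ?thesis using bs Cons.IH Cons.prems by (auto simp: b' rep blocks_Cons)
  qed
qed simp

lemma ex_blocks: "is_partition l \<Longrightarrow> \<exists>bs. blocks bs \<and> expand bs = l"
proof (induction l)
  case (Cons x l)
  then obtain bs where bs: "blocks bs" "expand bs = l" by (auto simp: is_partition_Cons)
  show ?case
  proof (cases bs)
    case Nil
    then show ?thesis using bs by (intro exI [of _ "[(x, 1)]"]) (auto simp: blocks_Cons)
  next
    case (Cons b bs')
    obtain v a where b: "b = (v, a)" by (cases b)
    have "v \<le> x" using Cons.prems bs Cons by (auto simp: b is_partition_Cons blocks_Cons)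
    show ?thesis
    proof (cases "v = x")
      case True
      then show ?thesis using bs Cons by (intro exI [of _ "(x, Suc a) # bs'"]) (auto simp: b blocks_Cons)
    next
      case False
      then show ?thesis using bs Cons \<open>v \<le> x\<close>
        by (intro exI [of _ "(x, 1) # bs"]) (auto simp: b blocks_Cons)
    qed
  qed
qed (auto intro: exI [of _ "[]"])

text \<open>Used for neighbours in \<open>blocks\<close>, whose values decrease, so the natural
  subtraction is exact.\<close>

definition JS_link :: "nat \<Rightarrow> nat \<times> nat \<Rightarrow> nat \<times> nat \<Rightarrow> bool" where
  "JS_link p b c \<longleftrightarrow> p dvd fst b - fst c + snd b + snd c"

lemma is_partition_expand: "blocks bs \<Longrightarrow> is_partition (expand bs) \<longleftrightarrow> (\<forall>b\<in>set bs. 0 < fst b)"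
proof (induction bs)
  case (Cons b bs)
  obtain v a where b: "b = (v, a)" by (cases b)
  have "\<forall>y\<in>set (expand bs). y \<le> v" using Cons.prems by (auto simp: b blocks_Cons set_expand)
  then have "is_partition (replicate n v @ expand bs) \<longleftrightarrow> (n = 0 \<or> 0 < v) \<and> is_partition (expand bs)" for n
    by (induction n) (auto simp: is_partition_Cons)
  then show ?case using Cons by (auto simp: b blocks_Cons)
qed simp

lemma p_regular_expand:
  assumes "blocks bs"
  shows "p_regular p (expand bs) \<longleftrightarrow> (\<forall>b\<in>set bs. 0 < fst b \<and> snd b \<le> p - 1)"
  using count_list_expand [OF assms]
  by (auto simp: p_regular_def is_partition_expand [OF assms] set_expand [OF assms])

lemma JS_partition_expand:
  assumes "blocks bs"
  shows "JS_partition p (expand bs) \<longleftrightarrow>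
    (\<forall>b\<in>set bs. 0 < fst b \<and> snd b \<le> p - 1) \<and> successively (JS_link p) bs"
  unfolding JS_partition_def Let_def remdups_adj_expand [OF assms] p_regular_expand [OF assms]
    successively_conv_nth JS_link_def cong_0_iff
  using count_list_expand [OF assms, OF nth_mem] by auto

section \<open>Residues of the beta numbers of JS-partitions and squares\<close>

lemma sum_ind_up: "p > 0 \<Longrightarrow> (\<Sum>i<p. ind p (x + int i) c) = 1"
proof -
  assume p: "p > 0"
  have "bij_betw (\<lambda>i. x + int i) {..<p} {x + int p - 1 - int p<..x + int p - 1}"
    by (rule bij_betw_byWitness [where f' = "\<lambda>y. nat (y - x)"]) auto
  from sum.reindex_bij_betw [OF this, of "\<lambda>y. ind p y c"] show ?thesis
    by (simp only: sum_ind_window [OF p])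
qed

lemma sum_ind_down: "p > 0 \<Longrightarrow> (\<Sum>i<p. ind p (x - int i) c) = 1"
proof -
  assume p: "p > 0"
  have "bij_betw (\<lambda>i. x - int i) {..<p} {x - int p<..x}"
    by (rule bij_betw_byWitness [where f' = "\<lambda>y. nat (x - y)"]) auto
  from sum.reindex_bij_betw [OF this, of "\<lambda>y. ind p y c"] sum_ind_window [OF p] show ?thesis by simp
qed

lemma sum_lessThan_add: "(\<Sum>i<m + n. f i) = (\<Sum>i<m. f i) + (\<Sum>i<n. f (m + i))" for f :: "nat \<Rightarrow> int"
  by (induction n) (auto simp: add.assoc)

text \<open>The first block has beta numbers v - a + 1, ..., v. The residues of the remaining rows
  form, by induction and after the shift by a rows, a run starting at w - b' + 1 - a, which the JS
  congruence makes congruent to v + 1; so the two runs join.\<close>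

lemma res_count_JS:
  assumes "blocks ((v, a) # bs)" "successively (JS_link p) ((v, a) # bs)"
  shows "res_count p (length (expand ((v, a) # bs))) (expand ((v, a) # bs)) c
    = (\<Sum>k<length (expand ((v, a) # bs)). ind p (int v - int a + 1 + int k) c)"
  using assms
proof (induction bs arbitrary: v a c)
  case Nil
  have "(\<Sum>i<a. ind p (int v - int i) c) = (\<Sum>k<a. ind p (int v - int a + 1 + int k) c)"
    by (subst sum.nat_diff_reindex [symmetric]) (auto intro!: sum.cong simp: algebra_simps)
  then show ?case by (simp add: res_count_def part_def)
next
  case (Cons b bs)
  obtain w b' where b: "b = (w, b')" by (cases b)
  let ?l = "expand (b # bs)" and ?r = "length (expand (b # bs))"
  have wv: "w < v" and dvd: "p dvd v - w + a + b'"
    using Cons.prems by (auto simp: b blocks_Cons JS_link_def)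
  have "int p dvd int (v - w + a + b')" using dvd by (simp only: int_dvd_int_iff)
  then have dvd': "int p dvd int v - int w + int a + int b'" using wv by (simp add: algebra_simps)
  have IH: "res_count p ?r ?l d = (\<Sum>k<?r. ind p (int w - int b' + 1 + int k) d)" for d
    using Cons.IH [of w b' d] Cons.prems by (simp add: b blocks_Cons)
  have "res_count p (a + ?r) (replicate a v @ ?l) c
      = (\<Sum>i<a. ind p (int v - int i) c) + (\<Sum>i<?r. ind p (int (part ?l i) - int (a + i)) c)"
    unfolding res_count_def sum_lessThan_add by (auto simp: part_def nth_append intro!: arg_cong2 [where f = "(+)"] sum.cong)
  \<comment> \<open>Standing a rows lower decreases every beta number by a, which is absorbed into
    the residue.\<close>
  also have "(\<Sum>i<?r. ind p (int (part ?l i) - int (a + i)) c) = res_count p ?r ?l (c + int a)"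
    unfolding res_count_def by (intro sum.cong ind_cong) auto
  also have "\<dots> = (\<Sum>k<?r. ind p (int v - int a + 1 + int (a + k)) c)"
    unfolding IH
  proof (intro sum.cong refl ind_cong)
    fix k
    have "(int w - int b' + 1 + int k - (c + int a)) - (int v - int a + 1 + int (a + k) - c)
       = - (int v - int w + int a + int b')" by simp
    then show "int p dvd (int w - int b' + 1 + int k - (c + int a)) - (int v - int a + 1 + int (a + k) - c)"
      using dvd' by (metis dvd_minus_iff)
  qed
  also have "(\<Sum>i<a. ind p (int v - int i) c) = (\<Sum>k<a. ind p (int v - int a + 1 + int k) c)"
    by (subst sum.nat_diff_reindex [symmetric]) (auto intro!: sum.cong simp: algebra_simps)
  finally have "res_count p (a + ?r) (replicate a v @ ?l) c = (\<Sum>k<a + ?r. ind p (int v - int a + 1 + int k) c)"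
    by (simp only: sum_lessThan_add)
  then show ?case by simp
qed

text \<open>The j rows have beta numbers j, ..., 1. The \<open>q * p\<close> zero rows, like the
  \<open>q * p\<close> integers after j, meet every class q times.\<close>

lemma res_count_square:
  assumes "p > 0"
  shows "res_count p (j + q * p) (replicate j j) c = (\<Sum>k<j + q * p. ind p (1 + int k) c)"
proof -
  have A: "(\<Sum>i<q * p. ind p (x + int i) c) = int q" for x
  proof (induction q)
    case (Suc q)
    have "(\<Sum>i<q * p + p. ind p (x + int i) c) = int q + (\<Sum>i<p. ind p ((x + int (q * p)) + int i) c)"
      unfolding sum_lessThan_add Suc by (simp add: add.assoc)
    also have "q * p + p = Suc q * p" by simp
    finally show ?case by (simp only: sum_ind_up [OF assms])
  qed simp
  have B: "(\<Sum>i<q * p. ind p (x - int i) c) = int q" for x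
  proof (induction q)
    case (Suc q)
    have "(\<Sum>i<q * p + p. ind p (x - int i) c) = int q + (\<Sum>i<p. ind p ((x - int (q * p)) - int i) c)"
      unfolding sum_lessThan_add Suc by (simp add: algebra_simps)
    also have "q * p + p = Suc q * p" by simp
    finally show ?case by (simp only: sum_ind_down [OF assms])
  qed simp
  have C: "(\<Sum>i<j. ind p (int j - int i) c) = (\<Sum>k<j. ind p (1 + int k) c)"
    by (subst sum.nat_diff_reindex [symmetric]) (auto intro!: sum.cong simp: algebra_simps)
  have "res_count p (j + q * p) (replicate j j) c
      = (\<Sum>i<j. ind p (int j - int i) c) + (\<Sum>i<q * p. ind p (- int j - int i) c)"
    unfolding res_count_def sum_lessThan_add by (auto simp: part_def intro!: arg_cong2 [where f = "(+)"] sum.cong)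
  also have "\<dots> = (\<Sum>k<j. ind p (1 + int k) c) + (\<Sum>i<q * p. ind p (1 + int j + int i) c)"
    by (simp only: A B C)
  also have "\<dots> = (\<Sum>k<j + q * p. ind p (1 + int k) c)"
    unfolding sum_lessThan_add by (simp add: add.assoc)
  finally show ?thesis .
qed

lemma is_partition_square: "is_partition (replicate j j)"
  by (auto simp: is_partition_def sorted_wrt_iff_nth_less)

text \<open>For j > 0 the rim of the square has 2j - 1 nodes, too few for a hook.\<close>

lemma square_terminal:
  assumes "2 * j < p + 1" "p > 0"
  shows "\<nexists>m. rim_hook_removal p (replicate j j) m"
proof
  assume "\<exists>m. rim_hook_removal p (replicate j j) m"
  then have "p \<le> length (rim (replicate j j))" by (auto simp: rim_hook_removal_def)
  moreover have "length (rim (replicate j j)) < p"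
    using length_rim [OF is_partition_square, of j] assms by (cases j) auto
  ultimately show False by simp
qed

text \<open>With v congruent to a, the run of residues in \<open>res_count_JS\<close> starts at 1,
  as it does for the padded square.\<close>

lemma p_core_JS:
  assumes "p > 0" "blocks ((v, a) # bs)" "JS_partition p (expand ((v, a) # bs))" "[v = a] (mod p)"
    "length (expand ((v, a) # bs)) = j + q * p" "2 * j < p + 1"
  shows "p_core p (expand ((v, a) # bs)) = replicate j j"
proof (rule p_core_eqI [where n = "j + q * p"])
  let ?l = "expand ((v, a) # bs)"
  show "is_partition ?l" using assms(3) by (simp add: JS_partition_def p_regular_def)
  show "\<nexists>m. rim_hook_removal p (replicate j j) m" using square_terminal assms by simp
  fix c
  have "int p dvd int v - int a" using assms(4) by (simp add: cong_iff_dvd_diff flip: cong_int_iff)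
  moreover have "res_count p (j + q * p) ?l c = (\<Sum>k<j + q * p. ind p (int v - int a + 1 + int k) c)"
    using res_count_JS [of v a bs p c] assms JS_partition_expand [OF assms(2)] by (simp only: assms(5))
  ultimately show "res_count p (j + q * p) ?l c = res_count p (j + q * p) (replicate j j) c"
    unfolding res_count_square [OF assms(1)] by (auto intro!: sum.cong ind_cong)
qed (use assms is_partition_square in auto)

section \<open>Existence\<close>

text \<open>Every row of a block except the last has a single rim node. The last row is left to the
  recursion, since its loss depends on \<open>ys\<close>.\<close>

lemma strip_replicate:
  assumes "0 < a" "a \<le> c" "0 < v"
  shows "strip p c (replicate a v @ ys) = replicate (a - 1) (v - 1) @ strip p (c - (a - 1)) (v # ys)"
  using assms
proof (induction a arbitrary: c)
  case (Suc a)
  show ?case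
  proof (cases a)
    case (Suc n)
    have "strip p c (replicate (Suc a) v @ ys) = (v - 1) # strip p (c - 1) (replicate a v @ ys)"
      using Suc Suc.prems by simp
    also have "\<dots> = (v - 1) # replicate (a - 1) (v - 1) @ strip p (c - 1 - (a - 1)) (v # ys)"
      using Suc.IH [of "c - 1"] Suc.prems Suc by simp
    finally show ?thesis using Suc by (simp del: strip.simps)
  qed simp
qed simp

definition selfconj :: "nat \<Rightarrow> nat list \<Rightarrow> bool" where
  "selfconj p l \<longleftrightarrow> mullineux_conj_symbol p (mullineux_symbol p l) = mullineux_symbol p l"

lemma selfconj_Nil [simp]: "selfconj p []"
  by (simp add: selfconj_def mullineux_conj_symbol_def)

text \<open>A column (a, r) equals its conjugate iff a = 2r or a + 1 = 2r, according to whether p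
  divides a; here a is read off as the loss in size.\<close>

lemma selfconj_step:
  assumes "is_partition l" "p > 0" "l \<noteq> []" "filter (\<lambda>x. 0 < x) (strip p p l) = m" "selfconj p m"
    "sum_list l = sum_list m + a" "if p dvd a then a = 2 * length l else a + 1 = 2 * length l"
  shows "selfconj p l"
proof -
  have "sum_list (strip p p l) = sum_list m" using sum_list_filter_pos [of "strip p p l"] assms(4) by simp
  then have "mullineux_symbol p l = (a, length l) # mullineux_symbol p m"
    using mullineux_symbol_strip [OF assms(1-3)] assms(4,6) by simp
  moreover have "a - length l + (if p dvd a then 0 else 1) = length l"
    using assms(7) \<open>l \<noteq> []\<close> by (cases l) (auto split: if_splits)
  ultimately show ?thesis using assms(5)
    by (simp add: selfconj_def mullineux_conj_symbol_def)
qed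

lemma strip_square:
  assumes "2 * j < p + 1" "0 < j"
  shows "strip p p (replicate j j) = replicate (j - 1) (j - 1) @ [0]"
  using strip_replicate [of j p j p "[]"] assms by simp

lemma filter_strip_square:
  assumes "2 * j < p + 1"
  shows "filter (\<lambda>x. 0 < x) (strip p p (replicate j j)) = replicate (j - 1) (j - 1)"
  using strip_square [OF assms] by (cases "j = 0") auto

lemma selfconj_square: "2 * j < p + 1 \<Longrightarrow> selfconj p (replicate j j)"
proof (induction j)
  case (Suc j)
  show ?case
  \<comment> \<open>The rim has 2j + 1 < p nodes and is a single p-segment.\<close>
  proof (rule selfconj_step [where m = "replicate j j" and a = "2 * j + 1"])
    show "filter (\<lambda>x. 0 < x) (strip p p (replicate (Suc j) (Suc j))) = replicate j j"
      using filter_strip_square [OF Suc.prems] by simp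
    show "if p dvd 2 * j + 1 then 2 * j + 1 = 2 * length (replicate (Suc j) (Suc j))
      else 2 * j + 1 + 1 = 2 * length (replicate (Suc j) (Suc j))"
      using Suc.prems dvd_imp_le [of p "2 * j + 1"] by auto
  qed (use Suc is_partition_square [of "Suc j"] in \<open>auto simp: sum_list_replicate\<close>)
qed simp

section \<open>The family \<open>row_balanced\<close>, for j < k\<close>

lemma expand_filter: "expand (filter (\<lambda>b. 0 < snd b) bs) = expand bs"
  by (induction bs) auto

lemma not_dvd_between: "q * p < a \<Longrightarrow> a < Suc q * p \<Longrightarrow> \<not> p dvd (a :: nat)"
proof
  assume *: "q * p < a" "a < Suc q * p" "p dvd a"
  then obtain m where m: "a = m * p" by (metis dvd_def mult.commute)
  from * have "q < m" "m < Suc q" unfolding m mult_less_cancel2 by auto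
  then show False by simp
qed

text \<open>
  The rows \<open>2, \<dots>, p\<close> contain \<open>kp - 1\<close> nodes and differ by at most one, that is
  \<open>v (p - 1) + r = kp - 1\<close> with \<open>r < p - 1\<close>.
\<close>

definition row_balanced :: "nat \<Rightarrow> nat \<Rightarrow> nat \<Rightarrow> nat \<Rightarrow> nat \<Rightarrow> nat list" where
  "row_balanced p k v r j =
     (k * p + 1) # replicate r (v + 1) @ replicate (p - 1 - r) v @ replicate j j"

text \<open>There are p + j parts and the first block is (kp + 1, 1), so \<open>p_core_JS\<close>
  applies with q = 1. The bounds on v make the square fit below and leave room for a whole p-segment
  in the first row.\<close>

lemma row_balanced_JS:
  assumes p: "p > 2" and v: "v * (p - 1) + r + 1 = k * p" and r: "r < p - 1" and j: "j < k" "2 * j < p + 1"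
  shows "JS_partition p (row_balanced p k v r j)"
    and "p_core p (row_balanced p k v r j) = replicate j j"
    and "j < v" "v \<le> (k - 1) * p + 1"
proof -
  \<comment> \<open>Since kp - 1 = k (p - 1) + (k - 1), the quotient v is at least k.\<close>
  have kv: "k \<le> v"
  proof (rule ccontr)
    assume "\<not> k \<le> v"
    then have "Suc v * (p - 1) \<le> k * (p - 1)" by (intro mult_right_mono) auto
    moreover have "k * p = k * (p - 1) + k" using p by (cases p) auto
    ultimately show False using v r \<open>\<not> k \<le> v\<close> by simp
  qed
  then show jv: "j < v" using j by simp
  have "v * 2 \<le> v * (p - 1)" using p by (intro mult_left_mono) auto
  then have v2: "2 * v + r + 1 \<le> k * p" using v by linarith
  show vk: "v \<le> (k - 1) * p + 1"
  proof (cases "k = 1")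
    case True
    have "v < 2"
    proof (rule ccontr)
      assume "\<not> v < 2"
      then have "2 * (p - 1) \<le> v * (p - 1)" by (intro mult_right_mono) auto
      moreover have "v * (p - 1) + r + 1 = p" using v True by simp
      ultimately show False using p by linarith
    qed
    then show ?thesis by simp
  next
    case False
    then obtain k' where "k = k' + 2" using j by (metis One_nat_def add_2_eq_Suc' less_nat_zero_code not0_implies_Suc)
    then show ?thesis using v2 by (simp add: algebra_simps)
  qed
  have pv: "v * p = v * (p - 1) + v" using p by (cases p) auto
  \<comment> \<open>Adding \<open>v * p\<close> turns the sum into 2kp; the next two divisibilities
    are obtained in the same way.\<close>
  have d1: "p dvd k * p + 1 - (v + 1) + 1 + r"
  proof -
    have "(k * p + 1 - (v + 1) + 1 + r) + v * p = 2 * k * p" using v pv v2 by simp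
    then show ?thesis by (metis dvd_add_left_iff dvd_triv_right)
  qed
  have d1': "p dvd k * p + 1 - v + 1 + (p - 1)" if "r = 0"
  proof -
    have "(k * p + 1 - v + 1 + (p - 1)) + v * p = (2 * k + 1) * p" using v pv v2 that p by simp
    then show ?thesis by (metis dvd_add_left_iff dvd_triv_right)
  qed
  have d2: "p dvd v - j + (p - 1 - r) + j"
  proof -
    have "(v - j + (p - 1 - r) + j) + k * p = (v + 1) * p" using pv v[symmetric] r jv by simp
    then show ?thesis by (metis dvd_add_left_iff dvd_triv_right)
  qed
  \<comment> \<open>Empty blocks are dropped, which covers r = 0 and j = 0.\<close>
  define bs where "bs = filter (\<lambda>b. 0 < snd b) [(v + 1, r), (v, p - 1 - r), (j, j)]"
  have ex: "row_balanced p k v r j = expand ((k * p + 1, 1) # bs)"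
    unfolding row_balanced_def bs_def expand_Cons expand_filter by simp
  have bl: "blocks ((k * p + 1, 1) # bs)" using v2 jv r by (auto simp: bs_def blocks_Cons)
  show JS: "JS_partition p (row_balanced p k v r j)"
    unfolding ex JS_partition_expand [OF bl]
    using jv r p j d1 d1' d2 by (auto simp: bs_def JS_link_def)
  show "p_core p (row_balanced p k v r j) = replicate j j"
    unfolding ex
  proof (rule p_core_JS [OF _ bl _ _ _ j(2), where q = 1])
    show "length (expand ((k * p + 1, 1) # bs)) = j + 1 * p"
      unfolding ex [symmetric] row_balanced_def using r by simp
    show "[k * p + 1 = 1] (mod p)" unfolding cong_def by (rule mod_mult_self3)
  qed (use JS ex p in auto)
qed

text \<open>The first p-segment lies in the first row, the second takes p nodes from the p - 1
  balanced rows, and what remains is the rim of the square. The balanced rows are left with (k - 1)p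
  - 1 nodes and are balanced again.\<close>

lemma row_balanced_step:
  assumes p: "p > 2" and v: "v * (p - 1) + r + 1 = k * p" and r: "r < p - 1" and j: "j < k" "2 * j < p + 1"
    and k: "k > 1"
  shows "\<exists>v' r'. v' * (p - 1) + r' + 1 = (k - 1) * p \<and> r' < p - 1 \<and>
    filter (\<lambda>x. 0 < x) (strip p p (row_balanced p k v r j)) = row_balanced p (k - 1) v' r' (j - 1)"
proof -
  let ?S = "replicate j j"
  note JS = row_balanced_JS [OF p v r j]
  have pv: "v * p = v * (p - 1) + v" using p by (cases p) auto
  have kp: "k * p = (k - 1) * p + p" using k by (cases k) auto
  have loS: "lo ?S < v" "j > 0 \<Longrightarrow> lo ?S < v - 1" using JS(3) by (cases j; simp)+
  have v2: "v \<ge> 2"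
  proof (rule ccontr)
    assume "\<not> v \<ge> 2"
    then have "v * (p - 1) \<le> 1 * (p - 1)" by (intro mult_right_mono) auto
    moreover have "1 * p \<le> (k - 1) * p" using k by (intro mult_right_mono) auto
    ultimately show False using v r kp by linarith
  qed
  have first: "strip p p ((k * p + 1) # rest) = ((k - 1) * p + 1) # strip p p rest" if "lo rest \<le> v" for rest
  proof -
    have "p \<le> k * p + 1 - lo rest" "k * p + 1 - p = (k - 1) * p + 1" using that JS(4) kp by linarith+
    then show ?thesis by simp
  qed
  show ?thesis
  proof (cases "r = 0")
    \<comment> \<open>Each of the p - 1 equal rows loses one node and the last one a second, so the
      new quotient is v - 2 with remainder p - 2.\<close>
    case True
    have lo0: "lo (replicate (p - 1) v @ ?S) = v - 1" using p by (cases "p - 1") auto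
    have "strip p p (replicate (p - 1) v @ ?S) = replicate (p - 2) (v - 1) @ strip p 2 (v # ?S)"
      using strip_replicate [of "p - 1" p v p ?S] v2 p by (simp del: strip.simps add: numeral_2_eq_2)
    also have "strip p 2 (v # ?S) = (v - 2) # strip p p ?S"
      using loS v2 by (cases "j = 0") auto
    finally have "strip p p (row_balanced p k v r j) =
        ((k - 1) * p + 1) # replicate (p - 2) (v - 1) @ (v - 2) # strip p p ?S"
      unfolding row_balanced_def using True lo0
      by (subst first) (simp_all del: strip.simps)
    then have "filter (\<lambda>x. 0 < x) (strip p p (row_balanced p k v r j)) =
        ((k - 1) * p + 1) # replicate (p - 2) (v - 1) @ filter (\<lambda>x. 0 < x) [v - 2] @ replicate (j - 1) (j - 1)"
      using v2 filter_strip_square [OF j(2)] by simp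
    moreover have v': "(v - 2) * (p - 1) + (p - 2) + 1 = (k - 1) * p"
    proof -
      obtain u where "v = u + 2" using v2 by (metis add.commute le_Suc_ex)
      then have "v * (p - 1) = (v - 2) * (p - 1) + 2 * (p - 1)" by (simp add: add_mult_distrib)
      then show ?thesis using v kp True p by linarith
    qed
    moreover have "v > 2"
    proof (rule ccontr)
      assume "\<not> v > 2"
      then have "p - 1 = (k - 1) * p" using v' p v2 by simp
      moreover have "1 * p \<le> (k - 1) * p" using k by (intro mult_right_mono) auto
      ultimately show False using p by linarith
    qed
    ultimately show ?thesis using p
      by (intro exI [of _ "v - 2"] exI [of _ "p - 2"]) (auto simp: row_balanced_def Suc_diff_Suc numeral_2_eq_2)
  next
    \<comment> \<open>Each row loses one node, except that the last row of length v + 1 loses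
      two.\<close>
    case False
    have lo2: "lo (replicate (p - 1 - r) v @ ?S) = v - 1" using r by (cases "p - 1 - r") auto
    have lo1: "lo (replicate r (v + 1) @ replicate (p - 1 - r) v @ ?S) = v" using False by (cases r) auto
    have "strip p p (replicate r (v + 1) @ replicate (p - 1 - r) v @ ?S) =
       replicate (r - 1) v @ strip p (p - (r - 1)) ((v + 1) # replicate (p - 1 - r) v @ ?S)"
      using strip_replicate [of r p "v + 1" p "replicate (p - 1 - r) v @ ?S"] r False by (simp del: strip.simps)
    also have "strip p (p - (r - 1)) ((v + 1) # replicate (p - 1 - r) v @ ?S)
       = (v - 1) # strip p (p - 1 - r) (replicate (p - 1 - r) v @ ?S)"
    proof -
      have "p - (r - 1) - (v + 1 - (v - 1)) = p - 1 - r" "\<not> p - (r - 1) \<le> v + 1 - (v - 1)"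
        using r False v2 by auto
      then show ?thesis unfolding strip.simps(2) lo2 by (simp only: if_False)
    qed
    also have "strip p (p - 1 - r) (replicate (p - 1 - r) v @ ?S) = replicate (p - 2 - r) (v - 1) @ strip p 1 (v # ?S)"
      using strip_replicate [of "p - 1 - r" "p - 1 - r" v p ?S] r v2 by (simp del: strip.simps add: numeral_2_eq_2)
    also have "strip p 1 (v # ?S) = (v - 1) # strip p p ?S" using loS by simp
    finally have "strip p p (row_balanced p k v r j) = ((k - 1) * p + 1) # replicate (r - 1) v @
        (v - 1) # replicate (p - 2 - r) (v - 1) @ (v - 1) # strip p p ?S"
      unfolding row_balanced_def first [OF eq_refl [OF lo1]] by (simp only: append_Cons append_assoc)
    also have "(v - 1) # replicate (p - 2 - r) (v - 1) @ (v - 1) # strip p p ?S = replicate (p - r) (v - 1) @ strip p p ?S"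
    proof -
      have "p - r = Suc (Suc (p - 2 - r))" using r by simp
      then show ?thesis by (simp add: replicate_app_Cons_same)
    qed
    finally have "filter (\<lambda>x. 0 < x) (strip p p (row_balanced p k v r j)) =
        ((k - 1) * p + 1) # replicate (r - 1) v @ replicate (p - r) (v - 1) @ replicate (j - 1) (j - 1)"
      using v2 filter_strip_square [OF j(2)] by simp
    moreover have "(v - 1) * (p - 1) + (r - 1) + 1 = (k - 1) * p"
    proof -
      obtain u where "v = u + 1" using v2 by (metis add.commute le_Suc_ex one_le_numeral order_trans)
      then have "v * (p - 1) = (v - 1) * (p - 1) + 1 * (p - 1)" by (simp add: add_mult_distrib)
      then show ?thesis using v kp False p by linarith
    qed
    ultimately show ?thesis using r v2 False
      by (intro exI [of _ "v - 1"] exI [of _ "r - 1"]) (auto simp: row_balanced_def)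
  qed
qed

lemma sum_list_row_balanced:
  assumes "v * (p - 1) + r + 1 = k * p" "r < p - 1"
  shows "sum_list (row_balanced p k v r j) = 2 * k * p + j * j"
proof -
  have "r * (v + 1) + (p - 1 - r) * v = ((p - 1 - r) + r) * v + r"
    by (simp add: distrib_left distrib_right)
  also have "\<dots> = v * (p - 1) + r" using assms(2) by simp
  finally show ?thesis using assms(1) by (simp add: row_balanced_def sum_list_replicate)
qed

text \<open>Induction along \<open>row_balanced_step\<close> down to k = 1, where j = 0 and the
  partition is (p + 1) followed by p - 1 parts equal to 1.\<close>

lemma selfconj_row_balanced:
  assumes "p > 2" "v * (p - 1) + r + 1 = k * p" "r < p - 1" "j < k" "2 * j < p + 1"
  shows "selfconj p (row_balanced p k v r j)"
  using assms
proof (induction k arbitrary: v r j rule: less_induct)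
  case (less k)
  let ?l = "row_balanced p k v r j"
  have part: "is_partition ?l"
    using row_balanced_JS(1) [OF less.prems] by (simp add: JS_partition_def p_regular_def)
  have len: "length ?l = p + j" using less.prems(3) by (simp add: row_balanced_def)
  have ne: "?l \<noteq> []" by (simp add: row_balanced_def)
  show ?case
  proof (cases "k = 1")
    case True
    have "j = 0" using less.prems True by simp
    have "v \<noteq> 0" using less.prems True by (metis add_0 less_diff_conv mult_0 nat_neq_iff nat_mult_1)
    moreover have "v \<le> 1" using row_balanced_JS(4) [OF less.prems] True by simp
    ultimately have v: "v = 1" by simp
    then have r: "r = 0" using less.prems True by simp
    have l: "?l = (p + 1) # replicate (p - 1) 1" using True v r \<open>j = 0\<close> by (simp add: row_balanced_def)
    have "strip p p (replicate (p - 1) 1) = replicate (p - 2) 0 @ strip p 2 [1]"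
      using strip_replicate [of "p - 1" p 1 p "[]"] less.prems(1) by (simp del: strip.simps add: numeral_2_eq_2)
    then have st: "filter (\<lambda>x. 0 < x) (strip p p ?l) = [1]"
      unfolding l using less.prems(1) by (cases "p - 1") auto
    show ?thesis
    proof (rule selfconj_step [OF part _ ne st, where a = "2 * p - 1"])
      show "selfconj p [1]" using selfconj_square [of 1 p] less.prems(1) by simp
      have "\<not> p dvd 2 * p - 1" using less.prems(1) by (intro not_dvd_between [of 1]) auto
      then show "if p dvd 2 * p - 1 then 2 * p - 1 = 2 * length ?l else 2 * p - 1 + 1 = 2 * length ?l"
        using len \<open>j = 0\<close> less.prems(1) by simp
    qed (use less.prems l in \<open>auto simp: sum_list_replicate\<close>)
  next
    case False
    then have k: "k > 1" using less.prems by simp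
    obtain v' r' where *: "v' * (p - 1) + r' + 1 = (k - 1) * p" "r' < p - 1"
      "filter (\<lambda>x. 0 < x) (strip p p ?l) = row_balanced p (k - 1) v' r' (j - 1)"
      using row_balanced_step [OF less.prems k] by blast
    \<comment> \<open>Two full segments and, for j > 0, the 2j - 1 rim nodes of the square.\<close>
    define a where "a = (if j = 0 then 2 * p else 2 * p + (2 * j - 1))"
    show ?thesis
    proof (rule selfconj_step [OF part _ ne *(3), where a = a])
      show "selfconj p (row_balanced p (k - 1) v' r' (j - 1))"
        using less.prems * k by (intro less.IH) auto
      have kp: "k * p = (k - 1) * p + p" using k by (cases k) auto
      have jj: "j * j = (j - 1) * (j - 1) + (2 * j - 1)" by (cases j) auto
      show "sum_list ?l = sum_list (row_balanced p (k - 1) v' r' (j - 1)) + a"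
        unfolding sum_list_row_balanced [OF less.prems(2,3)] sum_list_row_balanced [OF *(1,2)]
        using kp jj by (auto simp: a_def mult.assoc)
      have "\<not> p dvd a" if "j > 0"
        using that less.prems by (intro not_dvd_between [of 2]) (auto simp: a_def)
      then show "if p dvd a then a = 2 * length ?l else a + 1 = 2 * length ?l"
        by (auto simp: a_def len)
    qed (use less.prems in auto)
  qed
qed

section \<open>The family \<open>row_square\<close>, for k at most j\<close>

lemma res_count_pad:
  assumes "length l \<le> r"
  shows "res_count p (r + s) l c = res_count p r l c + (\<Sum>t<s. ind p (- int r - int t) c)"
proof -
  have "(\<Sum>i<s. ind p (int (part l (r + i)) - int (r + i)) c) = (\<Sum>t<s. ind p (- int r - int t) c)"
  proof (intro sum.cong refl)
    fix i
    have "int (part l (r + i)) - int (r + i) = - int r - int i" using assms by (simp add: part_def)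
    then show "ind p (int (part l (r + i)) - int (r + i)) c = ind p (- int r - int i) c" by (simp only:)
  qed
  then show ?thesis by (simp only: res_count_def sum_lessThan_add)
qed

text \<open>The beta numbers -r, ..., -(p - 1) of zero rows are congruent to s, ..., 1.\<close>

lemma sum_ind_reflect:
  assumes "r + s = p"
  shows "(\<Sum>t<s. ind p (- int r - int t) c) = (\<Sum>k<s. ind p (1 + int k) c)"
proof -
  have "(\<Sum>t<s. ind p (- int r - int t) c) = (\<Sum>t<s. ind p (1 + int (s - Suc t)) c)"
  proof (intro sum.cong refl ind_cong)
    fix t assume "t \<in> {..<s}"
    then have "(- int r - int t - c) - (1 + int (s - Suc t) - c) = - int p"
      using assms by (auto simp: of_nat_diff)
    then show "int p dvd (- int r - int t - c) - (1 + int (s - Suc t) - c)" by simp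
  qed
  also have "\<dots> = (\<Sum>k<s. ind p (1 + int k) c)"
    by (rule sum.nat_diff_reindex [of "\<lambda>k. ind p (1 + int k) c"])
  finally show ?thesis .
qed

text \<open>\<open>(p - j)\<close> parts give the core \<open>(j\<^sup>j)\<close> as well, since \<open>((p-j)\<^sup>p\<^sup>-\<^sup>j)\<close> has that core.\<close>

lemma p_core_JS_complement:
  assumes "p > 0" "blocks ((v, a) # bs)" "JS_partition p (expand ((v, a) # bs))" "[v = a] (mod p)"
    "length (expand ((v, a) # bs)) = p - j" "2 * j \<le> p"
  shows "p_core p (expand ((v, a) # bs)) = replicate j j"
proof (rule p_core_eqI [where n = p])
  let ?l = "expand ((v, a) # bs)"
  show "is_partition ?l" using assms(3) by (simp add: JS_partition_def p_regular_def)
  show "\<nexists>m. rim_hook_removal p (replicate j j) m" using square_terminal assms by simp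
  fix c
  have "int p dvd int v - int a" using assms(4) by (simp add: cong_iff_dvd_diff flip: cong_int_iff)
  moreover have "res_count p (p - j) ?l c = (\<Sum>k<p - j. ind p (int v - int a + 1 + int k) c)"
    using res_count_JS [of v a bs p c] assms JS_partition_expand [OF assms(2)] by (simp only: assms(5))
  ultimately have l: "res_count p (p - j) ?l c = (\<Sum>k<p - j. ind p (1 + int k) c)"
    by (auto intro!: sum.cong ind_cong)
  \<comment> \<open>Padding p - j parts to p rows adds the residues 1..j, and padding the square
    adds 1..p - j, so both sides have the same two runs.\<close>
  have "res_count p (p - j + j) ?l c = (\<Sum>k<p - j. ind p (1 + int k) c) + (\<Sum>k<j. ind p (1 + int k) c)"
    using res_count_pad [of ?l "p - j" p j c] sum_ind_reflect [of "p - j" j p c] assms l by simp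
  moreover have "res_count p (j + (p - j)) (replicate j j) c = (\<Sum>k<j. ind p (1 + int k) c) + (\<Sum>k<p - j. ind p (1 + int k) c)"
    using res_count_pad [of "replicate j j" j p "p - j" c] sum_ind_reflect [of j "p - j" p c] assms
      res_count_square [of p j 0 c] by simp
  ultimately show "res_count p p ?l c = res_count p p (replicate j j) c"
    using assms by simp
qed (use assms is_partition_square in auto)

text \<open>The multiplicities of k and k - 1 make the sums in the JS condition at these blocks
  equal to p when both are nonempty. For k = 1 the parts k - 1 would be zero and are omitted, which
  leaves p - j parts instead of p + j.\<close>

definition row_square :: "nat \<Rightarrow> nat \<Rightarrow> nat \<Rightarrow> nat list" where
  "row_square p k j = (k * p + 1) # replicate j (j + 2) @
     replicate (p + k - 2 - 2 * j) k @ replicate (if k = 1 then 0 else 2 * j + 1 - k) (k - 1)"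

lemma row_square_JS:
  assumes p: "p > 2" and j: "0 < k" "k \<le> j" "2 * j \<le> p" and k1: "k = 1 \<Longrightarrow> 2 * j + 2 \<le> p"
  shows "JS_partition p (row_square p k j)" and "p_core p (row_square p k j) = replicate j j"
    and "length (row_square p k j) = (if k = 1 then p - j else p + j)"
proof -
  define a where "a = p + k - 2 - 2 * j"
  define b where "b = (if k = 1 then 0 else 2 * j + 1 - k)"
  have ab: "k = 1 \<Longrightarrow> 0 < a" "a \<le> p - 1" "b \<le> p - 1" "k \<noteq> 1 \<Longrightarrow> a + b = p - 1 \<and> 0 < b"
    using j k1 p by (auto simp: a_def b_def)
  have kp: "p \<le> k * p" using j by (cases k) auto
  have kj: "j + 2 < k * p + 1"
  proof (cases "k = 1")
    case True
    then show ?thesis using j k1 by simp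
  next
    case False
    then have "2 * p \<le> k * p" using j by (intro mult_right_mono) auto
    then show ?thesis using j p by linarith
  qed
  define bs where "bs = filter (\<lambda>b. 0 < snd b) [(j + 2, j), (k, a), (k - 1, b)]"
  have ex: "row_square p k j = expand ((k * p + 1, 1) # bs)"
    unfolding row_square_def bs_def expand_Cons expand_filter by (simp add: a_def b_def)
  have "blocks ((t, 1) # bs)" if "j + 2 < t" for t
    using that j by (auto simp: bs_def blocks_Cons)
  from this [OF kj] have bl: "blocks ((k * p + 1, 1) # bs)" .
  show len: "length (row_square p k j) = (if k = 1 then p - j else p + j)"
    using j k1 by (auto simp: row_square_def)
  have d1: "p dvd k * p + 1 - (j + 2) + 1 + j"
  proof -
    have "k * p + 1 - (j + 2) + 1 + j = k * p" using kj by simp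
    then show ?thesis by (simp only: dvd_triv_right)
  qed
  have d2: "p dvd j + 2 - k + j + a" if "0 < a"
  proof -
    have "j + 2 - k + j + a = p" using that j by (simp add: a_def)
    then show ?thesis by (simp only: dvd_refl)
  qed
  have d3: "p dvd k - (k - 1) + a + b" if "0 < b"
  proof -
    have "k - (k - 1) + a + b = p" using that j p ab by (auto simp: b_def split: if_splits)
    then show ?thesis by (simp only: dvd_refl)
  qed
  \<comment> \<open>The block of k is empty only for k = 2 and p = 2j; then the blocks of j + 2 and
    k - 1 are neighbours and the sum is 2p.\<close>
  have d4: "p dvd j + 2 - (k - 1) + j + b" if "a = 0"
  proof -
    have "k \<noteq> 1" using that ab by auto
    then have "j + 2 - (k - 1) + j + b = p * 2" using that j k1 p by (auto simp: a_def b_def)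
    then show ?thesis by (simp only: dvd_triv_left)
  qed
  show JS: "JS_partition p (row_square p k j)"
    unfolding ex JS_partition_expand [OF bl]
    using ab j p d1 d2 d3 d4 by (auto simp: bs_def JS_link_def b_def)
  have cg: "[k * p + 1 = 1] (mod p)" unfolding cong_def by (rule mod_mult_self3)
  show "p_core p (row_square p k j) = replicate j j"
  proof (cases "k = 1")
    case True
    show ?thesis
      unfolding ex
      by (rule p_core_JS_complement [OF _ bl JS [unfolded ex] cg]) (use p len [unfolded ex] True j in auto)
  next
    case False
    show ?thesis
      unfolding ex
      by (rule p_core_JS [OF _ bl JS [unfolded ex] cg, where q = 1]) (use p len [unfolded ex] False j in auto)
  qed
qed

lemma sum_list_row_square:
  assumes "0 < k" "k \<le> j" "2 * j \<le> p" "k = 1 \<Longrightarrow> 2 * j + 2 \<le> p"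
  shows "sum_list (row_square p k j) = 2 * k * p + j * j"
proof (cases "k = 1")
  case True
  then show ?thesis using assms by (simp add: row_square_def sum_list_replicate algebra_simps)
next
  case False
  obtain i where i: "k = Suc i" using assms by (cases k) auto
  define b where "b = 2 * j + 1 - k"
  define a where "a = p + k - 2 - 2 * j"
  have b: "2 * j + 1 = k + b" using assms by (simp add: b_def)
  have a: "p + k = 2 + 2 * j + a" using assms False by (simp add: a_def)
  have p: "p = a + b + 1" using a b by simp
  have "sum_list (row_square p k j) = k * p + 1 + j * (j + 2) + a * k + b * (k - 1)"
    using a b False by (simp add: row_square_def sum_list_replicate)
  also have "\<dots> = k * p + 1 + j * j + 2 * j + a * k + b * i" using i by simp
  also have "\<dots> = 2 * k * p + j * j"
    using b unfolding p i by (simp add: algebra_simps)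
  finally show ?thesis .
qed

text \<open>The first segment lies in the first row. The second cuts the last row of length j + 2
  down to k - 1 and takes one node from each other row of length j + 2 or k. The third is the whole
  rim of the rectangle below, with 2j - 1 nodes.\<close>

lemma row_square_step:
  assumes p: "p > 2" and j: "1 < k" "k \<le> j" "2 * j \<le> p"
  shows "filter (\<lambda>x. 0 < x) (strip p p (row_square p k j)) = row_square p (k - 1) (j - 1)"
proof -
  define a where "a = p + k - 2 - 2 * j"
  define b where "b = 2 * j + 1 - k"
  let ?B = "replicate b (k - 1)"
  have b: "0 < b" "b \<le> p" using j by (auto simp: b_def)
  have kp: "k * p = (k - 1) * p + p" using j by (cases k) auto
  have pk: "p \<le> (k - 1) * p" using j by (cases "k - 1") auto
  have l: "row_square p k j = (k * p + 1) # replicate j (j + 2) @ replicate a k @ ?B"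
    using j by (simp add: row_square_def a_def b_def)
  have "lo (replicate j (j + 2) @ replicate a k @ ?B) = j + 1" using j by (cases j) auto
  moreover have "p \<le> k * p + 1 - (j + 1)" "k * p + 1 - p = (k - 1) * p + 1" using kp pk j by linarith+
  ultimately have "strip p p (row_square p k j) =
      ((k - 1) * p + 1) # strip p p (replicate j (j + 2) @ replicate a k @ ?B)"
    unfolding l by simp
  also have "strip p p (replicate j (j + 2) @ replicate a k @ ?B) =
      replicate (j - 1) (j + 1) @ strip p (p - (j - 1)) ((j + 2) # replicate a k @ ?B)"
    using strip_replicate [of j p "j + 2" p "replicate a k @ ?B"] j by (simp del: strip.simps)
  also have "strip p (p - (j - 1)) ((j + 2) # replicate a k @ ?B) = replicate (a + 1) (k - 1) @ strip p p ?B"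
  proof (cases "a = 0")
    case True
    have lo: "lo (replicate a k @ ?B) = k - 2" using True b by (cases b) auto
    have "p - (j - 1) \<le> j + 2 - (k - 2)" "j + 2 - (p - (j - 1)) = k - 1" using True j by (auto simp: a_def)
    then show ?thesis using True lo by simp
  next
    case False
    have lo: "lo (replicate a k @ ?B) = k - 1" using False by (cases a) auto
    have "\<not> p - (j - 1) \<le> j + 2 - (k - 1)" "p - (j - 1) - (j + 2 - (k - 1)) = a"
      using False j by (auto simp: a_def)
    then have "strip p (p - (j - 1)) ((j + 2) # replicate a k @ ?B) = (k - 1) # strip p a (replicate a k @ ?B)"
      using lo by simp
    also have "strip p a (replicate a k @ ?B) = replicate (a - 1) (k - 1) @ strip p 1 (k # ?B)"
      using strip_replicate [of a a k p ?B] False j by (simp del: strip.simps)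
    also have "strip p 1 (k # ?B) = (k - 1) # strip p p ?B"
      using j b by (cases b) auto
    also have "(k - 1) # replicate (a - 1) (k - 1) @ (k - 1) # strip p p ?B = replicate (a + 1) (k - 1) @ strip p p ?B"
      using False by (cases a) (auto simp: replicate_app_Cons_same)
    finally show ?thesis .
  qed
  also have "strip p p ?B = replicate (b - 1) (k - 2) @ [0]"
  proof -
    have "\<not> p - (b - 1) \<le> k - 1" using j by (auto simp: b_def)
    then show ?thesis using strip_replicate [of b p "k - 1" p "[]"] b j by (simp add: numeral_2_eq_2)
  qed
  finally have "filter (\<lambda>x. 0 < x) (strip p p (row_square p k j)) = ((k - 1) * p + 1) #
      replicate (j - 1) (j + 1) @ replicate (a + 1) (k - 1) @ replicate (if k - 1 = 1 then 0 else b - 1) (k - 2)"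
    using j by (cases "k = 2") auto
  moreover have "p + (k - 1) - 2 - 2 * (j - 1) = a + 1" "2 * (j - 1) + 1 - (k - 1) = b - 1" "j - 1 + 2 = j + 1" "k - 1 - 1 = k - 2"
    using j p by (auto simp: a_def b_def)
  ultimately show ?thesis unfolding row_square_def by (simp only:)
qed

lemma selfconj_row_square:
  assumes "p > 2" "0 < k" "k \<le> j" "2 * j \<le> p" "k = 1 \<Longrightarrow> 2 * j + 2 \<le> p"
  shows "selfconj p (row_square p k j)"
  using assms
proof (induction k arbitrary: j)
  case (Suc k)
  let ?l = "row_square p (Suc k) j"
  note JS = row_square_JS [OF Suc.prems]
  have part: "is_partition ?l"
    using JS(1) by (simp add: JS_partition_def p_regular_def)
  have ne: "?l \<noteq> []" by (simp add: row_square_def)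
  have sl: "sum_list ?l = 2 * Suc k * p + j * j"
    using Suc.prems by (intro sum_list_row_square) auto
  show ?case
  proof (cases "k = 0")
    case True
    \<comment> \<open>For k = 1 the first segment cuts the first row to j + 1 and takes one node
      from each of the next j rows; the second consists of the a parts equal to 1.\<close>
    define a where "a = p - 1 - 2 * j"
    have a: "0 < a" using Suc.prems True by (simp add: a_def)
    have l: "?l = (p + 1) # replicate j (j + 2) @ replicate a 1" using True by (simp add: row_square_def a_def)
    have "lo (replicate j (j + 2) @ replicate a 1) = j + 1" using Suc.prems by (cases j) auto
    then have "strip p p ?l = (j + 1) # strip p j (replicate j (j + 2) @ replicate a 1)"
      unfolding l using Suc.prems True by auto
    also have "strip p j (replicate j (j + 2) @ replicate a 1) = replicate (j - 1) (j + 1) @ strip p 1 ((j + 2) # replicate a 1)"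
      using strip_replicate [of j j "j + 2" p "replicate a 1"] Suc.prems by (simp del: strip.simps)
    also have "strip p 1 ((j + 2) # replicate a 1) = (j + 1) # strip p p (replicate a 1)"
      using a by (cases a) auto
    also have "strip p p (replicate a 1) = replicate (a - 1) 0 @ [0]"
      using strip_replicate [of a p 1 p "[]"] a Suc.prems by (auto simp: a_def)
    finally have st: "filter (\<lambda>x. 0 < x) (strip p p ?l) = replicate (Suc j) (Suc j)"
      using Suc.prems by (cases j) (auto simp: replicate_app_Cons_same)
    show ?thesis
    proof (rule selfconj_step [OF part _ ne st, where a = "p + a"])
      show "selfconj p (replicate (Suc j) (Suc j))" using selfconj_square [of "Suc j" p] Suc.prems True by simp
      have "\<not> p dvd p + a" using a by (intro not_dvd_between [of 1]) (auto simp: a_def)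
      moreover have "p + a + 1 = 2 * length ?l"
        using JS(3) Suc.prems True by (simp add: a_def)
      ultimately show "if p dvd p + a then p + a = 2 * length ?l else p + a + 1 = 2 * length ?l"
        by simp
      show "sum_list ?l = sum_list (replicate (Suc j) (Suc j)) + (p + a)"
        unfolding sl using True Suc.prems by (simp add: a_def sum_list_replicate)
    qed (use Suc.prems in auto)
  next
    case False
    have st: "filter (\<lambda>x. 0 < x) (strip p p ?l) = row_square p k (j - 1)"
      using row_square_step [of p "Suc k" j] Suc.prems False by simp
    have prems: "0 < k" "k \<le> j - 1" "2 * (j - 1) \<le> p" "k = 1 \<Longrightarrow> 2 * (j - 1) + 2 \<le> p"
      using Suc.prems False by auto
    have sl': "sum_list (row_square p k (j - 1)) = 2 * k * p + (j - 1) * (j - 1)"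
      using prems by (intro sum_list_row_square) auto
    show ?thesis
    proof (rule selfconj_step [OF part _ ne st, where a = "2 * p + (2 * j - 1)"])
      show "selfconj p (row_square p k (j - 1))" using Suc.IH Suc.prems(1) prems by blast
      have "\<not> p dvd 2 * p + (2 * j - 1)"
        using Suc.prems by (intro not_dvd_between [of 2]) auto
      then show "if p dvd 2 * p + (2 * j - 1) then 2 * p + (2 * j - 1) = 2 * length ?l
        else 2 * p + (2 * j - 1) + 1 = 2 * length ?l"
        using JS(3) Suc.prems False by simp
      have "j * j = (j - 1) * (j - 1) + (2 * j - 1)" by (cases j) auto
      then show "sum_list ?l = sum_list (row_square p k (j - 1)) + (2 * p + (2 * j - 1))"
        using sl sl' by simp
    qed (use Suc.prems in auto)
  qed
qed simp

section \<open>The remaining case k = 1, p = 2j\<close>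

definition double_row :: "nat \<Rightarrow> nat list" where
  "double_row j = replicate 2 (2 * j + 2) @ replicate (j - 2) (j + 2)"

text \<open>Replaces \<open>row_square\<close> where its multiplicity p - 1 - 2j would be negative.
  There are only j parts, so \<open>p_core_JS\<close> is used with q = 0.\<close>

lemma double_row_JS:
  assumes "j \<ge> 2"
  shows "JS_partition (2 * j) (double_row j)" and "p_core (2 * j) (double_row j) = replicate j j"
    and "length (double_row j) = j" and "sum_list (double_row j) = 2 * (2 * j) + j * j"
proof -
  define bs where "bs = filter (\<lambda>b. 0 < snd b) [(j + 2, j - 2)]"
  have ex: "double_row j = expand ((2 * j + 2, 2) # bs)"
    unfolding double_row_def bs_def expand_Cons expand_filter by simp
  have bl: "blocks ((2 * j + 2, 2) # bs)" using assms by (auto simp: bs_def blocks_Cons)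
  show JS: "JS_partition (2 * j) (double_row j)"
  proof -
    have "2 * j + 2 - (j + 2) + 2 + (j - 2) = 2 * j" using assms by simp
    then have "2 * j dvd 2 * j + 2 - (j + 2) + 2 + (j - 2)" by (simp only: dvd_refl)
    then show ?thesis
      unfolding ex JS_partition_expand [OF bl] using assms by (auto simp: bs_def JS_link_def)
  qed
  show len: "length (double_row j) = j" using assms by (simp add: double_row_def)
  show "p_core (2 * j) (double_row j) = replicate j j"
    unfolding ex
  proof (rule p_core_JS [OF _ bl, where q = 0])
    show "[2 * j + 2 = 2] (mod (2 * j))" unfolding cong_def by (rule mod_add_self1)
    show "JS_partition (2 * j) (expand ((2 * j + 2, 2) # bs))" using JS unfolding ex .
    show "length (expand ((2 * j + 2, 2) # bs)) = j + 0 * (2 * j)" unfolding ex [symmetric] len by simp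
  qed (use assms in auto)
  obtain i where "j = i + 2" using assms by (metis add.commute le_Suc_ex)
  then show "sum_list (double_row j) = 2 * (2 * j) + j * j"
    by (simp add: double_row_def sum_list_replicate algebra_simps)
qed

text \<open>Two p-rims of exactly p = 2j nodes lead through \<open>?m\<close> to the square; all
  three partitions have j parts, so the first two columns are (2j, j).\<close>

lemma selfconj_double_row:
  assumes "j \<ge> 2"
  shows "selfconj (2 * j) (double_row j)"
proof -
  let ?p = "2 * j"
  obtain i where i: "j = Suc (Suc i)" using assms by (metis Suc_le_D numeral_2_eq_2 Suc_le_mono)
  let ?m = "(?p + 1) # replicate (j - 1) (j + 1)"
  have pm: "is_partition ?m" using i by (auto simp: is_partition_def sorted_wrt_iff_nth_less nth_Cons split: nat.splits)
  have "strip ?p ?p ?m = j # strip ?p (j - 1) (replicate (j - 1) (j + 1) @ [])"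
    using i by simp
  also have "strip ?p (j - 1) (replicate (j - 1) (j + 1) @ []) = replicate (j - 2) j @ strip ?p 1 [j + 1]"
    using strip_replicate [of "j - 1" "j - 1" "j + 1" ?p "[]"] i by simp
  finally have st: "filter (\<lambda>x. 0 < x) (strip ?p ?p ?m) = replicate j j"
    using i by (simp add: replicate_append_same)
  have m: "selfconj ?p ?m"
    by (rule selfconj_step [OF pm _ _ st, where a = ?p])
      (use i selfconj_square [of j ?p] in \<open>auto simp: sum_list_replicate\<close>)
  have pl: "is_partition (double_row j)"
    using double_row_JS(1) [OF assms] by (simp add: JS_partition_def p_regular_def)
  have "strip ?p ?p (double_row j) = (?p + 1) # strip ?p (?p - 1) ((?p + 2) # replicate i (j + 2))"
    unfolding double_row_def i by (simp add: numeral_2_eq_2)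
  also have "strip ?p (?p - 1) ((?p + 2) # replicate i (j + 2)) = replicate (j - 1) (j + 1)"
  proof (cases "i = 0")
    case True
    then show ?thesis using i by simp
  next
    case False
    have lo: "lo (replicate i (j + 2)) = j + 1" using False by (cases i) auto
    have "strip ?p (?p - 1) ((?p + 2) # replicate i (j + 2)) = (j + 1) # strip ?p i (replicate i (j + 2) @ [])"
      using lo i by simp
    also have "strip ?p i (replicate i (j + 2) @ []) = replicate (i - 1) (j + 1) @ strip ?p 1 [j + 2]"
      using strip_replicate [of i i "j + 2" ?p "[]"] False by (simp del: strip.simps)
    finally show ?thesis using i False by (cases i) (auto simp: replicate_append_same)
  qed
  finally have st': "filter (\<lambda>x. 0 < x) (strip ?p ?p (double_row j)) = ?m" by simp
  show ?thesis
    by (rule selfconj_step [OF pl _ _ st' m, where a = ?p])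
      (use i double_row_JS [OF assms] in \<open>auto simp: sum_list_replicate\<close>)
qed

lemma ex_JS_fixed:
  assumes p: "p > 2" and j: "2 * j \<le> p" and ex: "\<not> (k = 1 \<and> p = 2 * j + 1)"
  shows "\<exists>l. JS_partition p l \<and> selfconj p l \<and> sum_list l = 2 * k * p + j * j \<and> p_core p l = replicate j j"
proof (cases "k = 0")
  case True
  have bl: "blocks (filter (\<lambda>b. 0 < snd b) [(j, j)])" by (simp add: blocks_Cons)
  have "JS_partition p (replicate j j)"
    using JS_partition_expand [OF bl, of p] p j unfolding expand_filter by auto
  moreover have "p_core p (replicate j j) = replicate j j"
    by (rule p_core_eqI [where n = j]) (use p j is_partition_square square_terminal in auto)
  ultimately show ?thesis
    using True selfconj_square [of j p] j by (intro exI [of _ "replicate j j"]) (auto simp: sum_list_replicate)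
next
  case k: False
  \<comment> \<open>For k = 1 at most j, the bound 2j + 2 <= p fails only for p = 2j and for the
    excluded p = 2j + 1.\<close>
  consider "j < k" | "k \<le> j" "k = 1 \<longrightarrow> 2 * j + 2 \<le> p" | "k = 1" "p = 2 * j" "k \<le> j"
    using ex j by linarith
  then show ?thesis
  proof cases
    case 1
    define v where "v = (k * p - 1) div (p - 1)"
    define r where "r = (k * p - 1) mod (p - 1)"
    have "v * (p - 1) + r = k * p - 1" unfolding v_def r_def by (rule div_mult_mod_eq)
    moreover have "0 < k * p" using k p by simp
    ultimately have v: "v * (p - 1) + r + 1 = k * p" by linarith
    have r: "r < p - 1" using p by (simp add: r_def)
    have j': "2 * j < p + 1" using j by simp
    show ?thesis
      using row_balanced_JS(1,2) [OF p v r 1 j'] selfconj_row_balanced [OF p v r 1 j'] sum_list_row_balanced [OF v r]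
      by blast
  next
    case 2
    then show ?thesis
      using row_square_JS(1,2) [of p k j] selfconj_row_square [of p k j] sum_list_row_square [of k j p] p j k by blast
  next
    case 3
    then have "j \<ge> 2" using p by simp
    then show ?thesis
      using double_row_JS [of j] selfconj_double_row [of j] 3 by auto
  qed
qed

section \<open>Nonexistence\<close>

text \<open>If 2j > p, the row \<open>i\<close> chosen here has a beta number that drops by p to a
  value in (-j, 0]. The j rows of the square have beta numbers 1..j, so this contradicts
  \<open>terminal_closed\<close>.\<close>

lemma square_p_core_bound:
  assumes "p > 0" "is_p_core p (replicate j j)"
  shows "2 * j \<le> p"
proof (rule ccontr)
  assume "\<not> 2 * j \<le> p"
  let ?l = "replicate j j"
  have core: "p_core p ?l = ?l" using assms(2) by (simp add: is_p_core_def)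
  have terminal: "\<nexists>m. rim_hook_removal p ?l m"
    using p_core_props(2) [OF assms(1) is_partition_square [of j]] unfolding core .
  define i where "i = j - min j p"
  have i: "i < j" "int j - int i - int p > - int j" "int j - int i \<le> int p"
    using \<open>\<not> 2 * j \<le> p\<close> assms(1) by (auto simp: i_def min_def)
  obtain k where "k < j" "int (part ?l i) - int i - int p = int (part ?l k) - int k"
    using terminal_closed [OF is_partition_square terminal assms(1), of j i] i by (auto simp: part_def)
  then show False using i by (simp add: part_def)
qed

section \<open>Shape of a single rim hook\<close>

lemma hd_diagram: "l \<noteq> [] \<Longrightarrow> (0, j) \<in> diagram l \<longleftrightarrow> j < hd l"
  by (cases l) (auto simp: diagram_def)

lemma length_diagram: "is_partition l \<Longrightarrow> (i, 0) \<in> diagram l \<longleftrightarrow> i < length l"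
proof -
  assume "is_partition l"
  then have "0 < l ! i" if "i < length l" using nth_mem [OF that] by (metis gr0I is_partition_def)
  then show ?thesis by (auto simp: diagram_def)
qed

text \<open>All of this follows from the p consecutive contents. A hook that shortens both the first
  row and the first column contains both ends of the rim, whose contents differ by
  \<open>hd l + length l - 2\<close>. A hook with p nodes in the first row or first column has no
  others.\<close>

lemma rim_hook_bounds:
  assumes "rim_hook_removal p l m" "l \<noteq> []" "m \<noteq> []"
  shows "hd m \<le> hd l" "hd l \<le> hd m + p" "length m \<le> length l" "length l \<le> length m + p"
    "hd l + length l \<le> p + 1 \<or> hd m = hd l \<or> length m = length l"
    "hd l = hd m + p \<Longrightarrow> diagram l = diagram m \<union> Pair 0 ` {hd m..<hd l}"
    "length l = length m + p \<Longrightarrow> diagram l = diagram m \<union> (\<lambda>i. (i, 0)) ` {length m..<length l}"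
proof -
  obtain H t where H: "H \<subseteq> diagram l" "diagram m = diagram l - H" "card H = p"
    "bij_betw content H {t - int p<..t}"
    using rim_hook_removalE [OF assms(1)] by metis
  have part: "is_partition l" "is_partition m" using assms(1) by (auto simp: rim_hook_removal_def)
  have fin: "finite H" using H(1) finite_diagram finite_subset by blast
  have win: "t - int p < content x \<and> content x \<le> t" if "x \<in> H" for x
    using bij_betwE [OF H(4)] that by auto
  have un: "diagram l = diagram m \<union> H" using H by auto
  have row: "(0, j) \<in> H \<longleftrightarrow> j < hd l \<and> \<not> j < hd m" for j
    using hd_diagram [OF assms(2), of j] hd_diagram [OF assms(3), of j] H by blast
  have col: "(i, 0) \<in> H \<longleftrightarrow> i < length l \<and> \<not> i < length m" for i
    using length_diagram [OF part(1), of i] length_diagram [OF part(2), of i] H by blast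
  show hd: "hd m \<le> hd l"
    using hd_diagram [OF assms(2), of "hd l"] hd_diagram [OF assms(3), of "hd l"] H by force
  show len: "length m \<le> length l" using length_rim_hook_removal [OF assms(1)] .
  show "hd l \<le> hd m + p"
  proof (cases "hd m < hd l")
    case True
    then have "(0, hd m) \<in> H" "(0, hd l - 1) \<in> H" unfolding row by linarith+
    then show ?thesis using win [of "(0, hd m)"] win [of "(0, hd l - 1)"] True by (simp add: content_def)
  qed simp
  show "length l \<le> length m + p"
  proof (cases "length m < length l")
    case True
    then have "(length m, 0) \<in> H" "(length l - 1, 0) \<in> H" unfolding col by linarith+
    then show ?thesis using win [of "(length m, 0)"] win [of "(length l - 1, 0)"] True by (simp add: content_def)
  qed simp
  show "hd l + length l \<le> p + 1 \<or> hd m = hd l \<or> length m = length l"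
  proof (rule disjCI)
    assume "\<not> (hd m = hd l \<or> length m = length l)"
    then have "hd m < hd l" "length m < length l" using hd len by auto
    then have "(0, hd l - 1) \<in> H" "(length l - 1, 0) \<in> H" unfolding row col by linarith+
    then show "hd l + length l \<le> p + 1"
      using win [of "(0, hd l - 1)"] win [of "(length l - 1, 0)"] \<open>hd m < hd l\<close> by (simp add: content_def)
  qed
  show "diagram l = diagram m \<union> Pair 0 ` {hd m..<hd l}" if "hd l = hd m + p"
  proof -
    have "Pair 0 ` {hd m..<hd l} \<subseteq> H" by (auto simp: row)
    moreover have "card (Pair (0::nat) ` {hd m..<hd l}) = card H" using that H(3) by (simp add: card_image inj_on_def)
    ultimately have "Pair 0 ` {hd m..<hd l} = H" by (rule card_subset_eq [OF fin])
    then show ?thesis using un by simp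
  qed
  show "diagram l = diagram m \<union> (\<lambda>i. (i, 0)) ` {length m..<length l}" if "length l = length m + p"
  proof -
    have "(\<lambda>i. (i, 0)) ` {length m..<length l} \<subseteq> H" by (auto simp: col)
    moreover have "card ((\<lambda>i. (i, 0::nat)) ` {length m..<length l}) = card H"
      using that H(3) by (simp add: card_image inj_on_def)
    ultimately have "(\<lambda>i. (i, 0)) ` {length m..<length l} = H" by (rule card_subset_eq [OF fin])
    then show ?thesis using un by simp
  qed
qed

lemma sum_list_relpowp:
  "(rim_hook_removal p ^^ n) l m \<Longrightarrow> sum_list l = sum_list m + n * p"
proof (induction n arbitrary: m)
  case (Suc n)
  then obtain y where "(rim_hook_removal p ^^ n) l y" "rim_hook_removal p y m" by (auto elim: relpowp_Suc_E)
  then show ?case using Suc.IH [of y] sum_list_rim_hook_removal [of p y m] by simp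
qed simp

text \<open>The p-rim is part of the rim, which has \<open>hd l + length l - 1\<close> nodes, and
  contains its first p nodes or all of it; so it is the whole rim if a < p.\<close>

lemma mullineux_fixed_first_column:
  assumes "mullineux_fixed p l" "is_partition l" "l \<noteq> []" "p > 0"
  shows "\<exists>a. (if p dvd a then a = 2 * length l else a + 1 = 2 * length l) \<and>
    a < hd l + length l \<and> (a < p \<longrightarrow> hd l + length l = a + 1)"
proof -
  define a where "a = card (p_rim p l)"
  have "mullineux_symbol p l = (a, length l) # mullineux_symbol p (remove_p_rim p l)"
    using assms by (simp add: mullineux_symbol.simps [of p l] a_def)
  then have eq: "a - length l + (if p dvd a then 0 else 1) = length l"
    using mullineux_fixedD [OF assms(1)] by (simp add: mullineux_conj_symbol_def)
  have hd: "0 < hd l" "0 < length l" using assms(2,3) by (cases l; auto simp: is_partition_Cons)+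
  have rim: "card (set (rim l)) = hd l + length l - 1"
    using distinct_card [OF distinct_rim, of l] length_rim [OF assms(2,3)] by simp
  have le: "a \<le> hd l + length l - 1"
    unfolding a_def rim [symmetric] by (rule card_mono [OF _ p_rim_subset]) simp
  have "set (take p (rim l)) \<subseteq> p_rim p l"
    unfolding p_rim_seg_nodes [OF assms(4)] seg_nodes_def by blast
  then have "card (set (take p (rim l))) \<le> a"
    unfolding a_def using p_rim_subset [of p l] by (intro card_mono) (auto intro: finite_subset)
  then have "min p (hd l + length l - 1) \<le> a"
    using distinct_card [OF distinct_take [OF distinct_rim], of p l] length_rim [OF assms(2,3)] by (simp add: min.commute)
  then have "a < p \<longrightarrow> hd l + length l = a + 1" "0 < a" using le hd assms(4) by linarith+
  moreover have "if p dvd a then a = 2 * length l else a + 1 = 2 * length l"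
    using eq hd \<open>0 < a\<close> by (auto split: if_splits)
  moreover have "a < hd l + length l" using le hd by linarith
  ultimately show ?thesis by blast
qed

lemma ind_nonneg: "0 \<le> ind p x c"
  by (simp add: ind_def)

text \<open>
  For \<open>r\<close> in the gap, the residue \<open>j + 2\<close> does not occur among the beta numbers of \<open>(j\<^sup>j)\<close> while \<open>j\<close>
  occurs twice; this is impossible for consecutive integers.
\<close>

lemma JS_length_gap:
  assumes p: "p = 2 * j + 1" and j: "0 < j" and "JS_partition p l" "l \<noteq> []"
    and cnt: "\<And>c. res_count p (length l) l c = res_count p (length l) (replicate j j) c"
  shows "length l \<le> j + 1 \<or> p + j \<le> length l"
proof (rule ccontr)
  let ?r = "length l"
  assume "\<not> ?thesis"
  then have r: "j + 2 \<le> ?r" "?r < p + j" by auto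
  obtain bs where bs: "blocks bs" "expand bs = l"
    using ex_blocks assms(3) by (auto simp: JS_partition_def p_regular_def)
  then obtain v a bs' where bs': "bs = (v, a) # bs'" using assms(4) by (cases bs) auto
  define x where "x = int v - int a + 1"
  have "successively (JS_link p) ((v, a) # bs')"
    using JS_partition_expand [OF bs(1), of p] assms(3) bs bs' by simp
  then have "res_count p ?r l c = (\<Sum>k<?r. ind p (x + int k) c)" for c
    using res_count_JS [of v a bs' p c] bs unfolding bs' x_def by metis
  then have l: "(\<Sum>k<?r. ind p (x + int k) c) = res_count p ?r (replicate j j) c" for c
    using cnt by simp
  have "ind p (int (part (replicate j j) i) - int i) (int j + 2) = 0" if "i < ?r" for i
  proof (cases "i < j")
    case True
    have "\<not> p dvd i + 2" using True p by (auto dest: dvd_imp_le)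
    then have "\<not> int p dvd - int (i + 2)" unfolding dvd_minus_iff int_dvd_int_iff .
    moreover have "int (part (replicate j j) i) - int i - (int j + 2) = - int (i + 2)"
      using True by (simp add: part_def)
    ultimately show ?thesis by (simp only: ind_def of_bool_def if_False)
  next
    case False
    have "\<not> p dvd i + j + 2" using False p r that by (intro not_dvd_between [of 1]) auto
    then have "\<not> int p dvd - int (i + j + 2)" unfolding dvd_minus_iff int_dvd_int_iff .
    moreover have "int (part (replicate j j) i) - int i - (int j + 2) = - int (i + j + 2)"
      using False by (simp add: part_def)
    ultimately show ?thesis by (simp only: ind_def of_bool_def if_False)
  qed
  then have zero: "(\<Sum>k<?r. ind p (x + int k) (int j + 2)) = 0"
    unfolding l res_count_def by simp
  \<comment> \<open>Any p consecutive integers include one congruent to j + 2.\<close>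
  have rp: "?r < p"
  proof (rule ccontr)
    assume "\<not> ?r < p"
    then have "(\<Sum>k<p. ind p (x + int k) (int j + 2)) \<le> (\<Sum>k<?r. ind p (x + int k) (int j + 2))"
      by (intro sum_mono2) (auto simp: ind_nonneg)
    then show False using zero sum_ind_up [of p x "int j + 2"] p by simp
  qed
  have "(\<Sum>k<?r. ind p (x + int k) (int j)) \<le> (\<Sum>k<p. ind p (x + int k) (int j))"
    using rp by (intro sum_mono2) (auto simp: ind_nonneg)
  then have "res_count p ?r (replicate j j) (int j) \<le> 1"
    unfolding l [symmetric] using sum_ind_up [of p x "int j"] p by simp
  \<comment> \<open>Rows 0 and j + 1 have beta numbers j and -(j + 1), which differ by p.\<close>
  moreover have "(\<Sum>i\<in>{0, j + 1}. ind p (int (part (replicate j j) i) - int i) (int j)) \<le> res_count p ?r (replicate j j) (int j)"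
    unfolding res_count_def using r by (intro sum_mono2) (auto simp: ind_nonneg)
  moreover have "ind p (int (part (replicate j j) 0) - int 0) (int j) = 1"
    using j by (simp add: ind_def part_def)
  moreover have "ind p (int (part (replicate j j) (j + 1)) - int (j + 1)) (int j) = 1"
  proof -
    have "int (part (replicate j j) (j + 1)) - int (j + 1) - int j = - int p" using p by (simp add: part_def)
    then show ?thesis by (simp only: ind_def) simp
  qed
  ultimately show False by simp
qed

lemma count_list_card: "count_list l x = card {i. i < length l \<and> l ! i = x}"
  by (auto simp: count_list_eq_length_filter length_filter_conv_card intro!: arg_cong [where f = card])

lemma no_JS_fixed:
  assumes p: "p = 2 * j + 1" and j: "0 < j" and JS: "JS_partition p l" and fixed: "mullineux_fixed p l"
    and core: "p_core p l = replicate j j" and weight: "p_weight p l = 2"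
  shows False
proof -
  let ?r = "length l" and ?q = "replicate j j"
  have p0: "p > 0" using p by simp
  have part: "is_partition l" and reg: "p_regular p l" using JS by (auto simp: JS_partition_def p_regular_def)
  have star: "(rim_hook_removal p)\<^sup>*\<^sup>* l ?q" using p_core_props(1) [OF p0 part] core by simp
  then obtain n where n: "(rim_hook_removal p ^^ n) l ?q" using rtranclp_imp_relpowp by metis
  have sum: "sum_list l = j * j + n * p"
    using sum_list_relpowp [OF n] by (simp add: sum_list_replicate)
  then have "n = 2" using weight core p0 by (simp add: p_weight_def sum_list_replicate)
  then obtain m where m: "rim_hook_removal p l m" "rim_hook_removal p m ?q"
    using n by (auto simp: numeral_2_eq_2)
  have ne: "l \<noteq> []" "?q \<noteq> []" using sum \<open>n = 2\<close> p0 j by auto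
  have "length ?q \<le> length m" using length_rim_hook_removal [OF m(2)] .
  then have ne': "m \<noteq> []" using j by auto
  note b1 = rim_hook_bounds [OF m(1) ne(1) ne'] and b2 = rim_hook_bounds [OF m(2) ne' ne(2)]
  have hq: "hd ?q = j" using j by (cases j) auto
  have cnt: "res_count p ?r l c = res_count p ?r ?q c" for c
    using res_count_rtranclp [OF star order_refl p0] by simp
  obtain a where a: "if p dvd a then a = 2 * ?r else a + 1 = 2 * ?r" "a < hd l + ?r"
    "a < p \<longrightarrow> hd l + ?r = a + 1"
    using mullineux_fixed_first_column [OF fixed part ne(1) p0] by blast
  have "?r \<ge> j" using b1(3) b2(3) by simp
  \<comment> \<open>Here a = 2j - 1 < p, so the first row has length j and the partition fits into
    the j by j square, which is too small.\<close>
  moreover have "?r \<noteq> j"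
  proof
    assume r: "?r = j"
    have "\<not> p dvd a"
    proof
      assume "p dvd a"
      then have "a = 2 * j" "p \<le> a" using a(1) r j by (auto intro: dvd_imp_le)
      then show False using p by simp
    qed
    then have "a + 1 = 2 * j" using a(1) r by simp
    then have "hd l = j" using a(3) p r by simp
    then have "\<forall>x\<in>set l. x \<le> j" using part ne(1) by (cases l) (auto simp: is_partition_Cons)
    then have "sum_list l \<le> j * j" using sum_list_mono [of l "\<lambda>x. x" "\<lambda>_. j"] r by (simp add: sum_list_triv)
    then show False using sum \<open>n = 2\<close> p0 by simp
  qed
  \<comment> \<open>Either a = p + 1, which p does not divide, or a = p, which it does; both
    contradict the case of the column condition they come from.\<close>
  moreover have "?r \<noteq> j + 1"
  proof
    assume r: "?r = j + 1"
    show False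
    proof (cases "p dvd a")
      case True
      then have "p dvd p + 1" using a(1) r p by simp
      then have "p dvd 1" by (metis dvd_add_right_iff dvd_refl)
      then show False using p j by simp
    next
      case False
      then have "a = p" using a(1) r p by simp
      then show False using False by simp
    qed
  qed
  ultimately have r: "p + j \<le> ?r" using JS_length_gap [OF p j JS ne(1) cnt] by linarith
  \<comment> \<open>The column condition gives a >= 2r - 1, while a < \<open>hd l\<close> +
    r.\<close>
  have h: "?r \<le> hd l" using a(1,2) by (auto split: if_splits)
  \<comment> \<open>As \<open>hd l\<close> + r > p + 1, the first removed hook leaves the first row
    or the first column unchanged. Each of these exceeds j by at least p, so one hook is a strip in
    the first row and the other a strip in the first column.\<close>
  have D: "diagram l = diagram ?q \<union> Pair 0 ` {j..<j + p} \<union> (\<lambda>i. (i, 0)) ` {j..<j + p}"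
  proof -
    have lq: "length ?q = j" by simp
    have "hd m = hd l \<or> length m = ?r" using b1(5) r h p j by linarith
    then show ?thesis
    proof
      assume hm: "hd m = hd l"
      then have 1: "hd m = j + p" using b2(2) r h hq by linarith
      then have 2: "length m = j" using b2(3,5) p0 hq lq j by linarith
      then have 3: "?r = length m + p" using b1(4) r by linarith
      show ?thesis
        using b1(7) [OF 3] b2(6) 1 2 3 hq by (simp add: add.commute)
    next
      assume lm: "length m = ?r"
      then have 1: "length m = j + p" using b2(4) r lq by linarith
      have "0 < hd m" using hd_diagram [OF ne', of 0] length_diagram [of m 0] ne' m(2)
        by (auto simp: rim_hook_removal_def)
      then have 2: "hd m = j" using b2(1,5) p0 hq lq 1 j by linarith
      then have 3: "hd l = hd m + p" using b1(2) r h by linarith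
      show ?thesis
        using b1(6) [OF 3] b2(7) 1 2 3 hq by (auto simp: add.commute)
    qed
  qed
  \<comment> \<open>The horizontal strip lies in row 0, above row j, so the rows j..j + p - 1
    consist of their node in column 0 alone.\<close>
  have "l ! i = 1 \<and> i < ?r" if i: "i \<in> {j..<j + p}" for i
  proof -
    have "(i, 0) \<in> diagram l" "(i, 1) \<notin> diagram l"
      unfolding D using i j by (auto simp: diagram_def)
    then show ?thesis by (auto simp: diagram_def)
  qed
  then have "{j..<j + p} \<subseteq> {i. i < ?r \<and> l ! i = 1}" by auto
  then have "p \<le> count_list l 1"
    unfolding count_list_card using card_mono [of "{i. i < ?r \<and> l ! i = 1}" "{j..<j + p}"] by simp
  moreover have "1 \<in> set l" using calculation p0 by (metis count_list_0_iff not_less_zero le_0_eq)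
  then have "count_list l 1 \<le> p - 1" using reg by (simp add: p_regular_def)
  ultimately show False using p0 by simp
qed

theorem theorem4p3:
  fixes p w :: nat and \<mu> :: "nat list"
  assumes "p > 2" and "even w"
    and "is_p_core p \<mu>"
    and "\<mu> = [] \<or> (\<exists>j\<ge>1. \<mu> = replicate j j)"
  shows "(\<exists>l. JS_partition p l \<and> mullineux_fixed p l \<and> p_weight p l = w \<and> p_core p l = \<mu>)
     \<longleftrightarrow> \<not> (w = 2 \<and> odd p \<and> \<mu> = replicate ((p - 1) div 2) ((p - 1) div 2))"
proof -
  obtain j where \<mu>: "\<mu> = replicate j j" using assms(4) by (metis replicate_0)
  have j: "2 * j \<le> p" using square_p_core_bound [of p j] assms \<mu> by simp
  obtain k where w: "w = 2 * k" using assms(2) by blast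
  show ?thesis
  proof (cases "w = 2 \<and> odd p \<and> \<mu> = replicate ((p - 1) div 2) ((p - 1) div 2)")
    case True
    then have "j = (p - 1) div 2" using \<mu> by (metis length_replicate)
    \<comment> \<open>Oddness of p makes the halved value exact.\<close>
    then have p: "p = 2 * j + 1" "0 < j" using True assms(1) by auto
    have False if "JS_partition p l" "mullineux_fixed p l" "p_weight p l = w" "p_core p l = \<mu>" for l
      using no_JS_fixed [OF p that(1,2)] that(3,4) True \<mu> by metis
    then show ?thesis using True by blast
  next
    case False
    then have "\<not> (k = 1 \<and> p = 2 * j + 1)" using w \<mu> by auto
    then obtain l where l: "JS_partition p l" "selfconj p l" "sum_list l = 2 * k * p + j * j" "p_core p l = replicate j j"
      using ex_JS_fixed [OF assms(1) j] by blast
    have "mullineux_fixed p l"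
      using l assms(1) by (intro mullineux_fixedI) (auto simp: JS_partition_def selfconj_def)
    moreover have "p_weight p l = w"
      using l assms(1) by (simp add: p_weight_def sum_list_replicate w)
    ultimately show ?thesis using False l \<mu> by blast
  qed
qed

end
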